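(* Let $W=W_1\oplus\cdots\oplus W_j$ and $W'=W'_1\oplus\cdots\oplus W'_{j'}$ be representations of the operator weights $W$ and $W'$ (defined on the same interval) as orthogonal direct sums of irreducible weights. If $W$ and $W'$ are equivalent, then $j=j'$ and there exists a permutation $\sigma$ of the set $\{1,\dots,j\}$ such that $W_i$ is equivalent to $W'_{\sigma(i)}$ for all $1\le i\le j$.
   Context: Let $V$ be a finite-dimensional complex inner product space. An operator weight (weight of linear operators on $V$) on an interval $(a,b)\subseteq\mathbb R$ is an integrable function $W:(a,b)\to\mathrm{End}(V)$ such that $W(x)$ is positive semidefinite (self-adjoint) for all $x$, positive definite for almost every $x$, and $\int_a^b x^nW(x)\,dx\in\mathrm{End}(V)$ exists for all integers $n\ge0$. Its size is $\dim V$. Two operator weights $W$ on $V$ and $W'$ on $V'$ on the same interval are equivalent if there is a linear isomorphism $T:V\to V'$ with $W'(x)=TW(x)T^*$ for all $x$. $W$ is the orthogonal direct sum $W_1\oplus\cdots\oplus W_d$ if $V$ is the orthogonal direct sum $V_1\oplus\cdots\oplus V_d$ where each subspace $V_i$ is nonzero and $W(x)$-invariant for all $x$ and $W_i(x)$ is the restriction of $W(x)$ to $V_i$. An operator weight is irreducible if it is not equivalent to an orthogonal direct sum of operator weights of smaller size. *)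

theory Defs
  imports "HOL-Analysis.Analysis" "HOL-Combinatorics.Permutations"
begin

text \<open>
  The inner product is linear in the first and conjugate-linear in the second argument.
  A finite-dimensional complex inner product space is represented as a finite-dimensional subspace
  of a type of this class, so that a space and its subspaces are treated uniformly.  Operators on
  \<open>V\<close> are functions on the ambient type of which only the values on \<open>V\<close> are ever used.
\<close>

class complex_inner = ab_group_add +
  fixes scaleC :: "complex \<Rightarrow> 'a \<Rightarrow> 'a"  (infixr "*\<^sub>C" 75)
    and cinner :: "'a \<Rightarrow> 'a \<Rightarrow> complex"
  assumes scaleC_add_right: "c *\<^sub>C (u + v) = c *\<^sub>C u + c *\<^sub>C v"
    and scaleC_add_left: "(c + d) *\<^sub>C v = c *\<^sub>C v + d *\<^sub>C v"
    and scaleC_scaleC: "c *\<^sub>C d *\<^sub>C v = (c * d) *\<^sub>C v"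
    and scaleC_one: "1 *\<^sub>C v = v"
    and cinner_commute: "cinner u v = cnj (cinner v u)"
    and cinner_add_left: "cinner (u + v) w = cinner u w + cinner v w"
    and cinner_scaleC_left: "cinner (c *\<^sub>C u) v = c * cinner u v"
    and cinner_ge_zero: "0 \<le> Re (cinner v v)"
    and cinner_eq_zero_iff: "cinner v v = 0 \<longleftrightarrow> v = 0"

global_interpretation complex_vector:
  vector_space "scaleC :: complex \<Rightarrow> 'a \<Rightarrow> 'a::complex_inner"
  by unfold_locales
    (simp_all add: scaleC_add_right scaleC_add_left scaleC_scaleC scaleC_one)

definition findim_space :: "'a::complex_inner set \<Rightarrow> bool" where
  "findim_space V \<longleftrightarrow> (\<exists>B. finite B \<and> V = complex_vector.span B)"

definition clinear_on ::
    "'a::complex_inner set \<Rightarrow> 'b::complex_inner set \<Rightarrow> ('a \<Rightarrow> 'b) \<Rightarrow> bool" where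
  "clinear_on V V' f \<longleftrightarrow>
     (\<forall>v\<in>V. f v \<in> V') \<and>
     (\<forall>u\<in>V. \<forall>v\<in>V. f (u + v) = f u + f v) \<and>
     (\<forall>c. \<forall>v\<in>V. f (c *\<^sub>C v) = c *\<^sub>C f v)"

definition adjoint_on :: "'a::complex_inner set \<Rightarrow> 'b::complex_inner set \<Rightarrow>
    ('a \<Rightarrow> 'b) \<Rightarrow> ('b \<Rightarrow> 'a) \<Rightarrow> bool" where
  "adjoint_on V V' T T' \<longleftrightarrow>
     clinear_on V' V T' \<and> (\<forall>v\<in>V. \<forall>w\<in>V'. cinner (T v) w = cinner v (T' w))"

definition possemidef_on :: "'a::complex_inner set \<Rightarrow> ('a \<Rightarrow> 'a) \<Rightarrow> bool" where
  "possemidef_on V A \<longleftrightarrow> adjoint_on V V A A \<and> (\<forall>v\<in>V. 0 \<le> Re (cinner (A v) v))"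

definition posdef_on :: "'a::complex_inner set \<Rightarrow> ('a \<Rightarrow> 'a) \<Rightarrow> bool" where
  "posdef_on V A \<longleftrightarrow> adjoint_on V V A A \<and> (\<forall>v\<in>V. v \<noteq> 0 \<longrightarrow> 0 < Re (cinner (A v) v))"

text \<open>
  The endpoints are extended reals, so unbounded intervals are included.  Since \<open>V\<close> is
  finite-dimensional, Lebesgue integrability of a function with values in \<open>End(V)\<close> is
  integrability of its matrix coefficients.
\<close>

definition operator_integrable ::
    "ereal \<Rightarrow> ereal \<Rightarrow> 'a::complex_inner set \<Rightarrow> (real \<Rightarrow> 'a \<Rightarrow> 'a) \<Rightarrow> bool" where
  "operator_integrable a b V F \<longleftrightarrow>
     (\<forall>u\<in>V. \<forall>v\<in>V. set_integrable lebesgue (einterval a b) (\<lambda>x. cinner (F x u) v))"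

definition operator_weight ::
    "ereal \<Rightarrow> ereal \<Rightarrow> 'a::complex_inner set \<Rightarrow> (real \<Rightarrow> 'a \<Rightarrow> 'a) \<Rightarrow> bool" where
  "operator_weight a b V W \<longleftrightarrow>
     findim_space V \<and>
     (\<forall>x\<in>einterval a b. clinear_on V V (W x)) \<and>
     operator_integrable a b V W \<and>
     (\<forall>x\<in>einterval a b. possemidef_on V (W x)) \<and>
     (AE x in lebesgue. x \<in> einterval a b \<longrightarrow> posdef_on V (W x)) \<and>
     (\<forall>n::nat. operator_integrable a b V (\<lambda>x v. complex_of_real (x ^ n) *\<^sub>C W x v))"

definition equivalent_weights :: "ereal \<Rightarrow> ereal \<Rightarrow>
    'a::complex_inner set \<Rightarrow> (real \<Rightarrow> 'a \<Rightarrow> 'a) \<Rightarrow>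
    'b::complex_inner set \<Rightarrow> (real \<Rightarrow> 'b \<Rightarrow> 'b) \<Rightarrow> bool" where
  "equivalent_weights a b V W V' W' \<longleftrightarrow>
     (\<exists>T T'. clinear_on V V' T \<and> bij_betw T V V' \<and> adjoint_on V V' T T' \<and>
        (\<forall>x\<in>einterval a b. \<forall>w\<in>V'. W' x w = T (W x (T' w))))"

text \<open>
  \<open>W = Ws 1 \<oplus> \<dots> \<oplus> Ws d\<close>, where \<open>Ws i\<close> acts on \<open>Vs i\<close>.  For \<open>d = 0\<close> this says \<open>V = {0}\<close>.
\<close>

definition orthogonal_direct_sum :: "ereal \<Rightarrow> ereal \<Rightarrow>
    'a::complex_inner set \<Rightarrow> (real \<Rightarrow> 'a \<Rightarrow> 'a) \<Rightarrow>
    nat \<Rightarrow> (nat \<Rightarrow> 'a set) \<Rightarrow> (nat \<Rightarrow> real \<Rightarrow> 'a \<Rightarrow> 'a) \<Rightarrow> bool" where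
  "orthogonal_direct_sum a b V W d Vs Ws \<longleftrightarrow>
     (\<forall>i\<in>{1..d}. complex_vector.subspace (Vs i) \<and> Vs i \<noteq> {0}) \<and>
     (\<forall>i\<in>{1..d}. \<forall>k\<in>{1..d}. i \<noteq> k \<longrightarrow> (\<forall>u\<in>Vs i. \<forall>v\<in>Vs k. cinner u v = 0)) \<and>
     V = {\<Sum>i=1..d. v i | v. \<forall>i\<in>{1..d}. v i \<in> Vs i} \<and>
     (\<forall>i\<in>{1..d}. \<forall>x\<in>einterval a b. \<forall>v\<in>Vs i. W x v \<in> Vs i \<and> Ws i x v = W x v)"

text \<open>
  The equivalent direct sum is sought on subspaces \<open>V'\<close> of the same ambient type.  This is no
  restriction: a space carrying a weight equivalent to \<open>W\<close> has the dimension of \<open>V\<close>, so it is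
  isometric to \<open>V\<close> itself, and isometries transport weights to equivalent weights and orthogonal
  direct sums to orthogonal direct sums.
\<close>

definition irreducible_weight ::
    "ereal \<Rightarrow> ereal \<Rightarrow> 'a::complex_inner set \<Rightarrow> (real \<Rightarrow> 'a \<Rightarrow> 'a) \<Rightarrow> bool" where
  "irreducible_weight a b V W \<longleftrightarrow>
     operator_weight a b V W \<and>
     \<not> (\<exists>(V' :: 'a set) W' d Vs Ws.
          operator_weight a b V' W' \<and>
          orthogonal_direct_sum a b V' W' d Vs Ws \<and>
          (\<forall>i\<in>{1..d}. operator_weight a b (Vs i) (Ws i) \<and>
             complex_vector.dim (Vs i) < complex_vector.dim V) \<and>
          equivalent_weights a b V W V' W')"

end

theory Submission
  imports Defs "HOL-Computational_Algebra.Fundamental_Theorem_Algebra"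
begin

text \<open>
  An equivalence \<open>W' = T W T\<^sup>*\<close> is the same as a linear bijection \<open>T\<^sup>*\<close> from \<open>V'\<close> to \<open>V\<close> that
  preserves all the Hermitian forms \<open>h\<^sub>x(u, v) = \<langle>W(x) u, v\<rangle>\<close>, one of which, \<open>h\<^sub>x\<^sub>0\<close>, is positive
  definite and serves as a new inner product.  Irreducibility of a weight means that its space has
  no nontrivial splitting that is orthogonal for all \<open>h\<^sub>x\<close>.  Schur's lemma then holds in the form:
  a nonzero map between irreducible spaces that has an adjoint common to all \<open>h\<^sub>x\<close> is a multiple of
  an isometry.  Applied to the projections of a summand \<open>V\<^sub>i\<close> onto the summands of the other
  decomposition, it shows that the sum of all \<open>V\<^sub>i\<close> in one isometry class lies in the
  corresponding sum for the other decomposition, so a dimension count gives equal multiplicities.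
\<close>

section \<open>Linear maps on subspaces\<close>

text \<open>The obstacle is that \<open>T\<close> need not be unitary: it can destroy orthogonality
  for \<open>cinner\<close>, so neither the splitting into summands nor the orthogonal projections
  onto them carry over from one space to the other. Only the forms survive. An orthogonal direct sum
  of weights is orthogonal for all of them at once, because each \<open>W x\<close> preserves the
  summands, and this weaker property is the one that is transported. In such a decomposition the
  component maps are self-adjoint for every form, so the projections between summands of two
  decompositions come with a common adjoint, namely the projection in the opposite direction. That
  is the input Schur's lemma asks for. Individual summands are not determined, as isometric ones can
  be mixed with each other; only the sum over an isometry class is canonical, so the matching has to
  come from counting.\<close>

lemma clinear_onD:
  assumes "clinear_on V V' f"
  shows "v \<in> V \<Longrightarrow> f v \<in> V'"
    and "u \<in> V \<Longrightarrow> v \<in> V \<Longrightarrow> f (u + v) = f u + f v"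
    and "v \<in> V \<Longrightarrow> f (c *\<^sub>C v) = c *\<^sub>C f v"
  using assms by (auto simp: clinear_on_def)

lemma clinear_on_diff:
  assumes f: "clinear_on V V' f" and V: "complex_vector.subspace V" and "u \<in> V" "v \<in> V"
  shows "f (u - v) = f u - f v"
proof -
  have "(-1) *\<^sub>C v \<in> V" by (rule complex_vector.subspace_scale[OF V assms(4)])
  then have "f (u + (-1) *\<^sub>C v) = f u + (-1) *\<^sub>C f v"
    using assms clinear_onD[OF f] by metis
  then show ?thesis by simp
qed

lemma clinear_on_zero:
  assumes f: "clinear_on V V' f" and V: "complex_vector.subspace V"
  shows "f 0 = 0"
  using clinear_on_diff[OF assms, of 0 0] V by (simp add: complex_vector.subspace_0)

lemma clinear_on_sum:
  assumes f: "clinear_on V V' f" and V: "complex_vector.subspace V" and "\<And>i. i \<in> I \<Longrightarrow> c i \<in> V"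
  shows "f (\<Sum>i\<in>I. c i) = (\<Sum>i\<in>I. f (c i))"
  using assms(3)
proof (induction I rule: infinite_finite_induct)
  case (insert i I)
  then show ?case
    by (simp add: clinear_onD(2)[OF f] complex_vector.subspace_sum[OF V])
qed (simp_all add: clinear_on_zero[OF f V])

lemma clinear_on_compose:
  "clinear_on A B f \<Longrightarrow> clinear_on B C g \<Longrightarrow> clinear_on A C (\<lambda>v. g (f v))"
  by (auto simp: clinear_on_def)

lemma clinear_on_inv_into:
  assumes f: "clinear_on A B f" and bij: "bij_betw f A B" and A: "complex_vector.subspace A"
  shows "clinear_on B A (inv_into A f)"
proof -
  let ?g = "inv_into A f"
  have g: "?g v \<in> A" "f (?g v) = v" if "v \<in> B" for v
    using bij that by (auto simp: bij_betw_def inv_into_into f_inv_into_f)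
  have gf: "?g (f v) = v" if "v \<in> A" for v
    using bij that by (auto simp: bij_betw_def)
  show ?thesis unfolding clinear_on_def
  proof (intro conjI ballI allI)
    fix u v assume uv: "u \<in> B" "v \<in> B"
    have "f (?g u + ?g v) = u + v" using uv g clinear_onD[OF f] by simp
    then show "?g (u + v) = ?g u + ?g v"
      using gf[of "?g u + ?g v"] uv g A by (simp add: complex_vector.subspace_add)
  next
    fix c v assume v: "v \<in> B"
    have "f (c *\<^sub>C ?g v) = c *\<^sub>C v" using v g clinear_onD[OF f] by simp
    then show "?g (c *\<^sub>C v) = c *\<^sub>C ?g v"
      using gf[of "c *\<^sub>C ?g v"] v g A by (simp add: complex_vector.subspace_scale)
  qed (use g in auto)
qed

lemma subspace_image_clinear_on:
  assumes f: "clinear_on A B f" and A: "complex_vector.subspace A"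
  shows "complex_vector.subspace (f ` A)"
proof (rule complex_vector.subspaceI)
  show "0 \<in> f ` A"
    using clinear_on_zero[OF f A] complex_vector.subspace_0[OF A] by (metis imageI)
next
  fix u v assume "u \<in> f ` A" "v \<in> f ` A"
  then obtain p q where "p \<in> A" "q \<in> A" "u = f p" "v = f q" by auto
  then show "u + v \<in> f ` A"
    using clinear_onD(2)[OF f, of p q] complex_vector.subspace_add[OF A, of p q] by (metis imageI)
next
  fix c u assume "u \<in> f ` A"
  then obtain p where "p \<in> A" "u = f p" by auto
  then show "c *\<^sub>C u \<in> f ` A"
    using clinear_onD(3)[OF f, of p c] complex_vector.subspace_scale[OF A, of p c] by (metis imageI)
qed

text \<open>Serves to turn equally large isometry classes into equal multisets of labels, from which
  a matching permutation can be extracted.\<close>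

lemma count_image_mset_set:
  assumes "finite A"
  shows "count (image_mset f (mset_set A)) z = card {x \<in> A. f x = z}"
proof -
  have "count (image_mset f (mset_set A)) z =
      (\<Sum>x | x \<in># mset_set A \<and> z = f x. count (mset_set A) x)"
    by (rule count_image_mset')
  also have "\<dots> = (\<Sum>x\<in>{x \<in> A. f x = z}. 1)"
    by (rule sum.cong) (use assms in auto)
  finally show ?thesis by simp
qed

section \<open>Finite dimension and eigenvectors\<close>

lemma findim_space_subspace: "findim_space V \<Longrightarrow> complex_vector.subspace V"
  by (auto simp: findim_space_def)

lemma findim_space_subset:
  assumes V: "findim_space V" and U: "complex_vector.subspace U" and sub: "U \<subseteq> V"
  shows "findim_space U"
proof -
  obtain B where B: "finite B" "V = complex_vector.span B" using V by (auto simp: findim_space_def)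
  obtain C where C: "C \<subseteq> U" "complex_vector.independent C" "U \<subseteq> complex_vector.span C"
    using complex_vector.maximal_independent_subset by blast
  have "finite C"
    using complex_vector.independent_span_bound[OF B(1) C(2)] C(1) sub B(2) by auto
  moreover have "U = complex_vector.span C"
    using C U by (metis complex_vector.span_minimal subset_antisym)
  ultimately show ?thesis by (auto simp: findim_space_def)
qed

text \<open>A spanning set of \<open>n\<close> vectors leaves no room for \<open>n + 1\<close>
  independent ones, and the coefficients of a dependence become those of a polynomial. Dependence is
  a property of the set of vectors, so a repetition \<open>s i = s k\<close> is invisible to it and
  is treated apart.\<close>

lemma findim_space_annihilating_poly:
  assumes U: "findim_space U" and s: "\<And>i. s i \<in> U"
  shows "\<exists>p. p \<noteq> 0 \<and> (\<Sum>i\<le>degree p. coeff p i *\<^sub>C s i) = 0"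
proof -
  obtain B where B: "finite B" "U = complex_vector.span B" using U by (auto simp: findim_space_def)
  define n where "n = card B"
  have bound: "(\<Sum>i\<le>degree p. coeff p i *\<^sub>C s i) = (\<Sum>i\<le>m. coeff p i *\<^sub>C s i)"
    if "degree p \<le> m" for p m
    by (rule sum.mono_neutral_left) (use that in \<open>auto simp: coeff_eq_0\<close>)
  show ?thesis
  proof (cases "inj_on s {..n}")
    case True
    then have "card (s ` {..n}) = Suc n" by (simp add: card_image)
    then have "complex_vector.dependent (s ` {..n})"
      using complex_vector.independent_span_bound[OF B(1), of "s ` {..n}"] s B(2)
      by (auto simp: n_def)
    then obtain c where c: "\<exists>v\<in>s ` {..n}. c v \<noteq> 0" "(\<Sum>v\<in>s ` {..n}. c v *\<^sub>C v) = 0"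
      by (auto simp: complex_vector.dependent_finite)
    define p where "p = (\<Sum>i\<le>n. monom (c (s i)) i)"
    have p: "coeff p i = (if i \<le> n then c (s i) else 0)" for i
      by (simp add: p_def coeff_sum)
    have "degree p \<le> n" by (rule degree_le) (simp add: p)
    moreover have "(\<Sum>i\<le>n. coeff p i *\<^sub>C s i) = 0"
      using c(2) True by (simp add: p sum.reindex)
    moreover have "p \<noteq> 0" using c(1) p by (metis atMost_iff coeff_0 imageE)
    ultimately show ?thesis using bound by metis
  next
    case False
    then obtain i k where ik: "i \<noteq> k" "s i = s k" "i \<le> n" "k \<le> n" by (auto simp: inj_on_def)
    define p :: "complex poly" where "p = monom 1 i - monom 1 k"
    have p: "coeff p m = (if m = i then 1 else 0) - (if m = k then 1 else 0)" for m
      by (simp add: p_def)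
    have "degree p \<le> n" by (rule degree_le) (use ik in \<open>auto simp: p\<close>)
    moreover have "(\<Sum>m\<le>n. coeff p m *\<^sub>C s m) = 0"
    proof -
      have "(\<Sum>m\<le>n. coeff p m *\<^sub>C s m) =
          (\<Sum>m\<le>n. (if m = i then s m else 0) - (if m = k then s m else 0))"
        by (intro sum.cong) (auto simp: p complex_vector.scale_left_diff_distrib)
      also have "\<dots> = s i - s k" using ik by (simp add: sum_subtractf)
      finally show ?thesis using ik by simp
    qed
    moreover have "coeff p i \<noteq> 0" using ik by (simp add: p)
    ultimately show ?thesis using bound by (metis coeff_0)
  qed
qed

text \<open>Instead of a determinant, the orbit \<open>s i\<close> of one nonzero vector is used.
  Among the nonzero polynomials with \<open>p(N) v = 0\<close>, one of least degree has a root
  \<open>c\<close>; dividing by the factor for \<open>c\<close> leaves \<open>q\<close>, and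
  \<open>q(N) v\<close> is an eigenvector, nonzero by minimality.\<close>

lemma clinear_on_eigenvalue:
  assumes U: "findim_space U" and N: "clinear_on U U N" and v: "v \<in> U" "v \<noteq> 0"
  shows "\<exists>c. \<exists>w\<in>U. w \<noteq> 0 \<and> N w = c *\<^sub>C w"
proof -
  note sU = findim_space_subspace[OF U]
  define s where "s i = (N ^^ i) v" for i
  have s: "s i \<in> U" for i
    by (induction i) (use v clinear_onD(1)[OF N] in \<open>auto simp: s_def\<close>)
  define ev where "ev p = (\<Sum>i\<le>degree p. coeff p i *\<^sub>C s i)" for p
  have bound: "ev p = (\<Sum>i\<le>m. coeff p i *\<^sub>C s i)" if "degree p \<le> m" for p m
    unfolding ev_def
    by (rule sum.mono_neutral_left) (use that in \<open>auto simp: coeff_eq_0\<close>)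
  have evU: "ev p \<in> U" for p
    unfolding ev_def
    by (intro complex_vector.subspace_sum[OF sU] complex_vector.subspace_scale[OF sU] s)
  obtain p where p: "p \<noteq> 0" "ev p = 0" and
    least: "\<And>q. q \<noteq> 0 \<Longrightarrow> ev q = 0 \<Longrightarrow> degree p \<le> degree q"
    using findim_space_annihilating_poly[OF U, of s] s
      exists_least_iff[of "\<lambda>n. \<exists>p. p \<noteq> 0 \<and> ev p = 0 \<and> degree p = n"]
    unfolding ev_def by (metis not_le)
  have "degree p \<noteq> 0"
  proof
    assume d: "degree p = 0"
    then have "coeff p 0 *\<^sub>C v = 0" using p(2) by (simp add: ev_def s_def)
    then show False using v d p(1) by (metis complex_vector.scale_eq_0_iff leading_coeff_0_iff)
  qed
  then obtain c where "poly p c = 0"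
    using fundamental_theorem_of_algebra[of p] by (auto simp: constant_degree)
  then obtain q where q: "p = [:- c, 1:] * q" by (auto simp: poly_eq_0_iff_dvd)
  then have q0: "q \<noteq> 0" using p by auto
  have deg: "degree p = Suc (degree q)" using q0 using degree_mult_eq[of "[:- c, 1:]" q] q by (simp del: mult_pCons_left)
  have "ev q \<noteq> 0" using least[OF q0] deg by auto
  moreover have "N (ev q) = c *\<^sub>C ev q"
  proof -
    let ?m = "degree q"
    have "ev p = (\<Sum>i\<le>Suc ?m. coeff p i *\<^sub>C s i)" by (simp add: ev_def deg)
    \<comment> \<open>This is \<open>p = X q - c q\<close> read coefficientwise; the extra index
      \<open>Suc ?m\<close> meets a zero coefficient of \<open>q\<close>.\<close>
    also have "\<dots> = (\<Sum>i\<le>Suc ?m. coeff (pCons 0 q) i *\<^sub>C s i - c *\<^sub>C coeff q i *\<^sub>C s i)"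
      by (intro sum.cong) (simp_all add: q complex_vector.scale_left_diff_distrib)
    also have "\<dots> = (\<Sum>i\<le>Suc ?m. coeff (pCons 0 q) i *\<^sub>C s i) - c *\<^sub>C ev q"
      using bound[of q "Suc ?m"] by (simp add: sum_subtractf complex_vector.scale_sum_right del: sum.atMost_Suc)
    also have "(\<Sum>i\<le>Suc ?m. coeff (pCons 0 q) i *\<^sub>C s i) = (\<Sum>i\<le>?m. coeff q i *\<^sub>C s (Suc i))"
      by (subst sum.atMost_Suc_shift) simp
    also have "\<dots> = N (ev q)"
      unfolding ev_def
      by (subst clinear_on_sum[OF N sU])
        (simp_all add: clinear_onD(3)[OF N] s complex_vector.subspace_scale[OF sU], simp add: s_def)
    finally show ?thesis using p(2) by simp
  qed
  ultimately show ?thesis using evU by blast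
qed

section \<open>Families of Hermitian forms\<close>

text \<open>All laws are demanded on \<open>V\<close> only, because operators are meaningful only
  there. Definiteness is asked at \<open>x0\<close> alone, as the other forms of a weight may be
  degenerate. The free index set lets \<open>cinner\<close> itself be an instance, with a single
  index.\<close>

locale form_space =
  fixes V :: "'a::complex_inner set" and X :: "'x set"
    and h :: "'x \<Rightarrow> 'a \<Rightarrow> 'a \<Rightarrow> complex" and x0 :: 'x
  assumes findim: "findim_space V"
    and x0: "x0 \<in> X"
    and h_add_left: "x \<in> X \<Longrightarrow> u \<in> V \<Longrightarrow> v \<in> V \<Longrightarrow> w \<in> V \<Longrightarrow> h x (u + v) w = h x u w + h x v w"
    and h_scale_left: "x \<in> X \<Longrightarrow> u \<in> V \<Longrightarrow> v \<in> V \<Longrightarrow> h x (c *\<^sub>C u) v = c * h x u v"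
    and h_commute: "x \<in> X \<Longrightarrow> u \<in> V \<Longrightarrow> v \<in> V \<Longrightarrow> h x u v = cnj (h x v u)"
    and h_pos: "v \<in> V \<Longrightarrow> v \<noteq> 0 \<Longrightarrow> 0 < Re (h x0 v v)"
begin

lemma subspace: "complex_vector.subspace V"
  by (rule findim_space_subspace[OF findim])

lemmas V_closed = complex_vector.subspace_add[OF subspace] complex_vector.subspace_diff[OF subspace]
  complex_vector.subspace_scale[OF subspace] complex_vector.subspace_sum[OF subspace]
  complex_vector.subspace_0[OF subspace]

lemma h_zero_left: "x \<in> X \<Longrightarrow> v \<in> V \<Longrightarrow> h x 0 v = 0"
  using h_add_left[of x 0 0 v] V_closed by simp

lemma h_diff_left:
  "x \<in> X \<Longrightarrow> u \<in> V \<Longrightarrow> v \<in> V \<Longrightarrow> w \<in> V \<Longrightarrow> h x (u - v) w = h x u w - h x v w"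
  using h_add_left[of x "u - v" v w] V_closed by simp

lemma h_sum_left:
  assumes "x \<in> X" "w \<in> V" "\<And>i. i \<in> I \<Longrightarrow> c i \<in> V"
  shows "h x (\<Sum>i\<in>I. c i) w = (\<Sum>i\<in>I. h x (c i) w)"
  using assms(3)
  by (induction I rule: infinite_finite_induct)
    (simp_all add: assms h_zero_left h_add_left V_closed)

lemma h_zero_right: "x \<in> X \<Longrightarrow> v \<in> V \<Longrightarrow> h x v 0 = 0"
  using h_commute[of x v 0] h_zero_left[of x v] V_closed by simp

lemma h_add_right:
  "x \<in> X \<Longrightarrow> u \<in> V \<Longrightarrow> v \<in> V \<Longrightarrow> w \<in> V \<Longrightarrow> h x w (u + v) = h x w u + h x w v"
  using h_commute[of x w] h_add_left[of x u v w] V_closed by simp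

lemma h_diff_right:
  "x \<in> X \<Longrightarrow> u \<in> V \<Longrightarrow> v \<in> V \<Longrightarrow> w \<in> V \<Longrightarrow> h x w (u - v) = h x w u - h x w v"
  using h_commute[of x w] h_diff_left[of x u v w] V_closed by simp

lemma h_scale_right: "x \<in> X \<Longrightarrow> u \<in> V \<Longrightarrow> v \<in> V \<Longrightarrow> h x u (c *\<^sub>C v) = cnj c * h x u v"
  using h_commute[of x u] h_scale_left[of x v u c] V_closed by simp

lemma h_definite: "v \<in> V \<Longrightarrow> h x0 v v = 0 \<Longrightarrow> v = 0"
  using h_pos by fastforce

lemma h_self_real: "x \<in> X \<Longrightarrow> v \<in> V \<Longrightarrow> h x v v = of_real (Re (h x v v))"
  using h_commute[of x v v] by (metis Reals_cnj_iff of_real_Re)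

section \<open>Orthonormal bases and orthogonal projections for the definite form\<close>

definition orthonormal :: "'a set \<Rightarrow> bool" where
  "orthonormal E \<longleftrightarrow> finite E \<and> E \<subseteq> V \<and>
     (\<forall>e\<in>E. h x0 e e = 1) \<and> (\<forall>e\<in>E. \<forall>f\<in>E. e \<noteq> f \<longrightarrow> h x0 e f = 0)"

lemma orthonormal_coefficient:
  assumes E: "orthonormal E" and e: "e \<in> E"
  shows "h x0 (\<Sum>f\<in>E. c f *\<^sub>C f) e = c e"
proof -
  have EV: "f \<in> V" if "f \<in> E" for f using E that by (auto simp: orthonormal_def)
  have "h x0 (\<Sum>f\<in>E. c f *\<^sub>C f) e = (\<Sum>f\<in>E. h x0 (c f *\<^sub>C f) e)"
    by (rule h_sum_left) (use EV e x0 V_closed in auto)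
  also have "\<dots> = (\<Sum>f\<in>E. if f = e then c e else 0)"
    by (rule sum.cong) (use E e EV x0 in \<open>auto simp: h_scale_left orthonormal_def\<close>)
  also have "\<dots> = c e" using E e by (simp add: orthonormal_def)
  finally show ?thesis .
qed

lemma orthonormal_independent:
  assumes E: "orthonormal E"
  shows "complex_vector.independent E"
proof
  assume "complex_vector.dependent E"
  moreover have "finite E" using E by (simp add: orthonormal_def)
  ultimately obtain c f where c: "(\<Sum>e\<in>E. c e *\<^sub>C e) = 0" "f \<in> E" "c f \<noteq> 0"
    by (auto simp: complex_vector.dependent_finite)
  moreover have "f \<in> V" using E c by (auto simp: orthonormal_def)
  ultimately show False
    using orthonormal_coefficient[OF E, of f c] h_zero_left x0 by simp
qed

lemma orthonormal_card_le:
  assumes "orthonormal E" "orthonormal F" "E \<subseteq> complex_vector.span F"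
  shows "card E \<le> card F"
  using complex_vector.independent_span_bound[of F E] assms orthonormal_independent
  by (auto simp: orthonormal_def)

lemma h_eq_on_span:
  assumes E: "E \<subseteq> V" and uv: "u \<in> V" "v \<in> V" and x: "x \<in> X"
    and eq: "\<And>e. e \<in> E \<Longrightarrow> h x u e = h x v e" and w: "w \<in> complex_vector.span E"
  shows "h x u w = h x v w"
proof -
  have "w \<in> V \<and> h x u w = h x v w"
    using w
  proof (induction rule: complex_vector.span_induct_alt)
    case base
    show ?case using x uv by (simp add: V_closed h_zero_right)
  next
    case (step c e w)
    then have "e \<in> V" using E by auto
    then show ?case using step eq x uv by (simp add: V_closed h_add_right h_scale_right)
  qed
  then show ?thesis by simp
qed

lemma orthonormal_projection:
  assumes E: "orthonormal E" and v: "v \<in> V" and w: "w \<in> complex_vector.span E"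
  shows "h x0 (\<Sum>e\<in>E. h x0 v e *\<^sub>C e) w = h x0 v w"
proof -
  have EV: "f \<in> V" if "f \<in> E" for f using E that by (auto simp: orthonormal_def)
  show ?thesis
    by (rule h_eq_on_span[OF _ _ v x0 _ w])
      (use EV orthonormal_coefficient[OF E] in \<open>auto intro!: V_closed\<close>)
qed

lemma gram_schmidt:
  assumes "finite B" "B \<subseteq> V"
  shows "\<exists>E. orthonormal E \<and> complex_vector.span E = complex_vector.span B"
  using assms
proof (induction B rule: finite_induct)
  case empty
  show ?case by (rule exI[of _ "{}"]) (simp add: orthonormal_def)
next
  case (insert b B)
  then obtain E where E: "orthonormal E" and span: "complex_vector.span E = complex_vector.span B"
    by auto
  have EV: "f \<in> V" if "f \<in> E" for f using E that by (auto simp: orthonormal_def)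
  have bV: "b \<in> V" using insert by simp
  have span_ins: "complex_vector.span (insert b E) = complex_vector.span (insert b B)"
    using span by (simp add: complex_vector.span_insert)
  show ?case
  proof (cases "b \<in> complex_vector.span E")
    case True
    then show ?thesis using E span_ins by (metis complex_vector.span_redundant)
  next
    case False
    \<comment> \<open>\<open>p\<close> is the orthogonal projection of \<open>b\<close> to the span
      of \<open>E\<close>; the remainder \<open>d\<close> is nonzero because \<open>b\<close> lies
      outside that span, so it can be normalized by its length \<open>r\<close>.\<close>
    define p where "p = (\<Sum>e\<in>E. h x0 b e *\<^sub>C e)"
    define d where "d = b - p"
    define r where "r = sqrt (Re (h x0 d d))"
    define e0 where "e0 = complex_of_real (inverse r) *\<^sub>C d"
    have p: "p \<in> complex_vector.span E"
      unfolding p_def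
      by (intro complex_vector.span_sum complex_vector.span_scale complex_vector.span_base)
    then have d0: "d \<noteq> 0" using False by (auto simp: d_def)
    have pV: "p \<in> V" using EV by (auto simp: p_def intro!: V_closed)
    then have dV: "d \<in> V" using bV by (simp add: d_def V_closed)
    have r: "r > 0" using h_pos[OF dV d0] by (simp add: r_def)
    have rr: "h x0 d d = complex_of_real (r * r)"
      using h_self_real[OF x0 dV] h_pos[OF dV d0] by (simp add: r_def)
    have e0V: "e0 \<in> V" using dV by (simp add: e0_def V_closed)
    have e0e0: "h x0 e0 e0 = 1"
      using r dV x0 by (simp add: e0_def h_scale_left h_scale_right V_closed rr field_simps)
    have de: "h x0 d e = 0" if "e \<in> E" for e
      using orthonormal_projection[OF E bV, of e] that EV bV pV x0
      by (simp add: d_def h_diff_left p_def[symmetric] complex_vector.span_base)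
    have e0e: "h x0 e0 e = 0" "h x0 e e0 = 0" if "e \<in> E" for e
      using de[OF that] EV[OF that] dV e0V x0 h_commute[OF x0 EV[OF that] e0V]
      by (simp_all add: e0_def h_scale_left)
    have "orthonormal (insert e0 E)"
      using E e0V e0e0 e0e by (auto simp: orthonormal_def)
    moreover have "complex_vector.span (insert e0 E) = complex_vector.span (insert b E)"
    proof (rule complex_vector.span_eq[THEN iffD2], intro conjI subsetI)
      have "d \<in> complex_vector.span (insert b E)"
        unfolding d_def using p complex_vector.span_mono[of E "insert b E"]
        by (metis complex_vector.span_base complex_vector.span_diff insertI1 subset_insertI subsetD)
      then show "v \<in> complex_vector.span (insert b E)" if "v \<in> insert e0 E" for v
        using that complex_vector.span_base[of v "insert b E"] by (auto simp: e0_def complex_vector.span_scale)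
      have "d = complex_of_real r *\<^sub>C e0" using r by (simp add: e0_def complex_vector.scale_scale flip: of_real_mult)
      then have "b = complex_of_real r *\<^sub>C e0 + p" unfolding d_def by (metis diff_add_cancel)
      then have "b \<in> complex_vector.span (insert e0 E)"
        using p complex_vector.span_mono[of E "insert e0 E"] complex_vector.span_base[of e0 "insert e0 E"]
        by (metis complex_vector.span_add complex_vector.span_scale insertI1 subset_insertI subsetD)
      then show "v \<in> complex_vector.span (insert e0 E)" if "v \<in> insert b E" for v
        using that by (auto simp: complex_vector.span_base)
    qed
    ultimately show ?thesis using span_ins by auto
  qed
qed

lemma orthonormal_basis_exists:
  assumes "complex_vector.subspace U" "U \<subseteq> V"
  shows "\<exists>E. orthonormal E \<and> complex_vector.span E = U"
proof -
  obtain B where "finite B" "U = complex_vector.span B"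
    using findim_space_subset[OF findim assms] by (auto simp: findim_space_def)
  then show ?thesis using gram_schmidt[of B] assms complex_vector.span_superset[of B] by auto
qed

text \<open>Expansion in an orthonormal basis of \<open>U\<close>. The map is tied to
  \<open>h x0\<close>; the other forms may degenerate and need not give projections of their own, so
  compatibility with them has to be obtained separately.\<close>

lemma projection_exists:
  assumes U: "complex_vector.subspace U" "U \<subseteq> V"
  shows "\<exists>Q. clinear_on V U Q \<and> (\<forall>v\<in>V. \<forall>w\<in>U. h x0 (Q v) w = h x0 v w)"
proof -
  obtain E where E: "orthonormal E" "complex_vector.span E = U"
    using orthonormal_basis_exists[OF U] by auto
  have EV: "f \<in> V" if "f \<in> E" for f using E that by (auto simp: orthonormal_def)
  define Q where "Q v = (\<Sum>e\<in>E. h x0 v e *\<^sub>C e)" for v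
  have "Q v \<in> U" for v
    unfolding Q_def E(2)[symmetric]
    by (intro complex_vector.span_sum complex_vector.span_scale complex_vector.span_base)
  then have "clinear_on V U Q"
    unfolding clinear_on_def
    by (auto simp: Q_def h_add_left h_scale_left x0 EV complex_vector.scale_left_distrib
        sum.distrib complex_vector.scale_sum_right)
  then show ?thesis using orthonormal_projection[OF E(1)] E(2) unfolding Q_def by blast
qed

lemma h_eqI:
  assumes U: "complex_vector.subspace U" "U \<subseteq> V" and "u \<in> U" "v \<in> U"
    and eq: "\<And>w. w \<in> U \<Longrightarrow> h x0 u w = h x0 v w"
  shows "u = v"
proof -
  have d: "u - v \<in> U" using assms complex_vector.subspace_diff by blast
  have "h x0 (u - v) (u - v) = 0"
    using eq[OF d] assms d x0 by (subst h_diff_left) auto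
  then show ?thesis using h_definite[of "u - v"] d U by auto
qed

end

text \<open>A splitting is automatically direct wherever one of the forms is definite. The zero
  space counts as irreducible here, so summands are asked to be nonzero separately where they are
  counted.\<close>

definition form_irreducible ::
    "'x set \<Rightarrow> ('x \<Rightarrow> 'a::complex_inner \<Rightarrow> 'a \<Rightarrow> complex) \<Rightarrow> 'a set \<Rightarrow> bool" where
  "form_irreducible X h U \<longleftrightarrow>
     (\<forall>A B. complex_vector.subspace A \<and> complex_vector.subspace B \<and> A \<subseteq> U \<and> B \<subseteq> U \<and>
        (\<forall>u\<in>U. \<exists>p\<in>A. \<exists>q\<in>B. u = p + q) \<and> (\<forall>x\<in>X. \<forall>p\<in>A. \<forall>q\<in>B. h x p q = 0) \<longrightarrow>
        A = {0} \<or> B = {0})"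

section \<open>Schur's lemma\<close>

context form_space
begin

text \<open>If \<open>c\<close> is an eigenvalue, then the kernel and the range of \<open>N - c\<close> split \<open>U\<close> orthogonally.\<close>

lemma selfadjoint_scalar:
  assumes U: "complex_vector.subspace U" "U \<subseteq> V" "U \<noteq> {0}" and irr: "form_irreducible X h U"
    and N: "clinear_on U U N"
    and adj: "\<And>x u v. x \<in> X \<Longrightarrow> u \<in> U \<Longrightarrow> v \<in> U \<Longrightarrow> h x (N u) v = h x u (N v)"
  shows "\<exists>c::real. \<forall>u\<in>U. N u = of_real c *\<^sub>C u"
proof -
  have UV: "u \<in> V" if "u \<in> U" for u using U that by auto
  have NU: "N u \<in> U" if "u \<in> U" for u using clinear_onD(1)[OF N that] .
  obtain v where "v \<in> U" "v \<noteq> 0" using U(1,3) complex_vector.subspace_0 by blast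
  then obtain c w where w: "w \<in> U" "w \<noteq> 0" "N w = c *\<^sub>C w"
    using clinear_on_eigenvalue[OF findim_space_subset[OF findim U(1,2)] N] by blast
  \<comment> \<open>The eigenvalue is real, since definiteness at \<open>x0\<close> allows division
    by \<open>h x0 w w\<close>. Reality makes \<open>N - c\<close> self-adjoint for every
    form.\<close>
  have "c * h x0 w w = cnj c * h x0 w w"
    using adj[OF x0 w(1) w(1)] w(3) x0 UV[OF w(1)] by (simp add: h_scale_left h_scale_right)
  moreover have "h x0 w w \<noteq> 0" using h_definite[OF UV[OF w(1)]] w(2) by blast
  ultimately have "cnj c = c" by simp
  define M where "M u = N u - c *\<^sub>C u" for u
  have M: "clinear_on U U M"
    unfolding clinear_on_def M_def
    using U(1) by (auto simp: NU clinear_onD(2,3)[OF N] complex_vector.scale_right_distrib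
        complex_vector.scale_right_diff_distrib mult.commute
        intro!: complex_vector.subspace_diff complex_vector.subspace_scale)
  have MU: "M u \<in> U" if "u \<in> U" for u using clinear_onD(1)[OF M that] .
  have Madj: "h x (M u) v = h x u (M v)" if "x \<in> X" "u \<in> U" "v \<in> U" for x u v
    using that adj[OF that] NU UV \<open>cnj c = c\<close>
    by (simp add: M_def h_diff_left h_diff_right h_scale_left h_scale_right V_closed)
  define A where "A = {u \<in> U. M u = 0}"
  define B where "B = M ` U"
  have A: "complex_vector.subspace A"
    unfolding A_def using clinear_onD[OF M] U(1) clinear_on_zero[OF M U(1)]
    by (auto intro!: complex_vector.subspaceI
        simp: complex_vector.subspace_0 complex_vector.subspace_add complex_vector.subspace_scale)
  have B: "complex_vector.subspace B" unfolding B_def by (rule subspace_image_clinear_on[OF M U(1)])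
  have BU: "B \<subseteq> U" using MU by (auto simp: B_def)
  obtain Q where Q: "clinear_on V B Q" "\<And>v w. v \<in> V \<Longrightarrow> w \<in> B \<Longrightarrow> h x0 (Q v) w = h x0 v w"
    using projection_exists[OF B] BU U(2) by blast
  have split: "\<exists>p\<in>A. \<exists>q\<in>B. u = p + q" if u: "u \<in> U" for u
  proof -
    have QB: "Q u \<in> B" using clinear_onD(1)[OF Q(1)] UV[OF u] .
    define p where "p = u - Q u"
    have pU: "p \<in> U" using QB BU u U(1) by (auto simp: p_def complex_vector.subspace_diff)
    \<comment> \<open>\<open>p\<close> is the part of \<open>u\<close> that is orthogonal to the
      range for \<open>h x0\<close>, and \<open>M (M p)\<close> lies in the range, so definiteness
      forces \<open>p\<close> into the kernel.\<close>
    have "h x0 (M p) (M p) = h x0 p (M (M p))" using Madj[OF x0 pU MU[OF pU]] .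
    also have "\<dots> = 0"
    proof -
      have MB: "M (M p) \<in> B" using MU[OF pU] by (auto simp: B_def)
      then have "M (M p) \<in> V" using BU UV by auto
      then show ?thesis
        using Q(2)[OF UV[OF u] MB] QB BU UV u x0 unfolding p_def by (subst h_diff_left) auto
    qed
    finally have "M p = 0" using h_definite UV MU pU by blast
    then have "p \<in> A" using pU by (simp add: A_def)
    then show ?thesis using QB by (intro bexI[of _ p] bexI[of _ "Q u"]) (auto simp: p_def)
  qed
  \<comment> \<open>The complement was built with \<open>h x0\<close> alone, but kernel and range
    are orthogonal for every form because \<open>M\<close> is self-adjoint for every form.\<close>
  have orth: "h x p q = 0" if x: "x \<in> X" and pq: "p \<in> A" "q \<in> B" for x p q
  proof -
    obtain u where u: "u \<in> U" "q = M u" using pq by (auto simp: B_def)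
    have p: "p \<in> U" "M p = 0" using pq by (auto simp: A_def)
    show ?thesis using Madj[OF x p(1) u(1)] u p x UV h_zero_left by simp
  qed
  have "A = {0} \<or> B = {0}"
    using irr A B BU split orth unfolding form_irreducible_def A_def by blast
  moreover have "w \<in> A" using w by (simp add: A_def M_def)
  ultimately have "B = {0}" using w by auto
  then have "M u = 0" if "u \<in> U" for u using that by (auto simp: B_def)
  then have "N u = c *\<^sub>C u" if "u \<in> U" for u using that by (simp add: M_def)
  moreover have "c = of_real (Re c)" using \<open>cnj c = c\<close> by (simp add: complex_eq_iff)
  ultimately show ?thesis by metis
qed

text \<open>For summands invariant under all \<open>W x\<close>, this is equivalence of the
  restricted weights, phrased without adjoints.\<close>

definition isometric :: "'a set \<Rightarrow> 'a set \<Rightarrow> bool" where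
  "isometric A B \<longleftrightarrow> (\<exists>f. clinear_on A B f \<and> bij_betw f A B \<and>
     (\<forall>x\<in>X. \<forall>u\<in>A. \<forall>v\<in>A. h x (f u) (f v) = h x u v))"

lemma isometric_refl: "isometric A A"
  unfolding isometric_def by (rule exI[of _ "\<lambda>v. v"]) (auto simp: clinear_on_def bij_betw_def)

lemma isometric_sym:
  assumes A: "complex_vector.subspace A" and iso: "isometric A B"
  shows "isometric B A"
proof -
  obtain f where f: "clinear_on A B f" "bij_betw f A B"
    "\<And>x u v. x \<in> X \<Longrightarrow> u \<in> A \<Longrightarrow> v \<in> A \<Longrightarrow> h x (f u) (f v) = h x u v"
    using iso by (auto simp: isometric_def)
  let ?g = "inv_into A f"
  have "h x (?g u) (?g v) = h x u v" if "x \<in> X" "u \<in> B" "v \<in> B" for x u v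
    using f(3)[of x "?g u" "?g v"] that f(2)
    by (auto simp: bij_betw_def inv_into_into f_inv_into_f)
  then show ?thesis
    unfolding isometric_def using clinear_on_inv_into[OF f(1,2) A] bij_betw_inv_into[OF f(2)] by blast
qed

lemma isometric_trans:
  assumes "isometric A B" "isometric B C"
  shows "isometric A C"
proof -
  obtain f where f: "clinear_on A B f" "bij_betw f A B"
    "\<And>x u v. x \<in> X \<Longrightarrow> u \<in> A \<Longrightarrow> v \<in> A \<Longrightarrow> h x (f u) (f v) = h x u v"
    using assms(1) by (auto simp: isometric_def)
  obtain g where g: "clinear_on B C g" "bij_betw g B C"
    "\<And>x u v. x \<in> X \<Longrightarrow> u \<in> B \<Longrightarrow> v \<in> B \<Longrightarrow> h x (g u) (g v) = h x u v"
    using assms(2) by (auto simp: isometric_def)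
  show ?thesis
    unfolding isometric_def
    using clinear_on_compose[OF f(1) g(1)] bij_betw_trans[OF f(2) g(2)] f(3) g(3) clinear_onD(1)[OF f(1)]
    by (intro exI[of _ "\<lambda>v. g (f v)"]) (simp add: comp_def)
qed

text \<open>Both \<open>g f\<close> and \<open>f g\<close> are self-adjoint, hence scalars.\<close>

lemma schur:
  assumes U: "complex_vector.subspace U" "U \<subseteq> V" "form_irreducible X h U"
    and U': "complex_vector.subspace U'" "U' \<subseteq> V" "form_irreducible X h U'"
    and f: "clinear_on U U' f" and g: "clinear_on U' U g"
    and adj: "\<And>x u v. x \<in> X \<Longrightarrow> u \<in> U \<Longrightarrow> v \<in> U' \<Longrightarrow> h x (f u) v = h x u (g v)"
    and u0: "u0 \<in> U" "f u0 \<noteq> 0"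
  shows "isometric U U'"
proof -
  have fU: "f u \<in> U'" if "u \<in> U" for u using clinear_onD(1)[OF f that] .
  have gU: "g u \<in> U" if "u \<in> U'" for u using clinear_onD(1)[OF g that] .
  have adj': "h x (g v) u = h x v (f u)" if "x \<in> X" "u \<in> U" "v \<in> U'" for x u v
  proof -
    have "h x (g v) u = cnj (h x u (g v))" using h_commute[of x "g v" u] that gU U(2) U'(2) by blast
    also have "\<dots> = h x v (f u)" using h_commute[of x v "f u"] adj[OF that] that fU U(2) U'(2)
      by (metis subsetD)
    finally show ?thesis .
  qed
  have "u0 \<noteq> 0" using u0 clinear_on_zero[OF f U(1)] by metis
  then have "U \<noteq> {0}" "U' \<noteq> {0}" using u0 fU by auto
  obtain c :: real where c: "\<And>u. u \<in> U \<Longrightarrow> g (f u) = of_real c *\<^sub>C u"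
    using selfadjoint_scalar[OF U(1,2) \<open>U \<noteq> {0}\<close> U(3) clinear_on_compose[OF f g]] adj adj' fU gU by metis
  obtain d :: real where d: "\<And>u. u \<in> U' \<Longrightarrow> f (g u) = of_real d *\<^sub>C u"
    using selfadjoint_scalar[OF U'(1,2) \<open>U' \<noteq> {0}\<close> U'(3) clinear_on_compose[OF g f]] adj adj' fU gU by metis
  \<comment> \<open>\<open>f (g (f u0))\<close> is evaluated in two ways; since \<open>f u0\<close>
    is nonzero, the two scalars agree.\<close>
  have "of_real d *\<^sub>C f u0 = of_real c *\<^sub>C f u0"
    using d[OF fU[OF u0(1)]] c[OF u0(1)] clinear_onD(3)[OF f u0(1)] by metis
  then have dc: "d = c" using u0(2) by simp
  have hff: "h x (f u) (f v) = of_real c * h x u v" if "x \<in> X" "u \<in> U" "v \<in> U" for x u v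
  proof -
    have "u \<in> V" "v \<in> V" using that U(2) by auto
    then show ?thesis
      using adj[OF that(1,2) fU[OF that(3)]] c[OF that(3)] h_scale_right[OF that(1), of u v "of_real c"]
      by simp
  qed
  have "c * Re (h x0 u0 u0) = Re (h x0 (f u0) (f u0))" using hff[OF x0 u0(1) u0(1)] by simp
  also have "\<dots> > 0" using h_pos[of "f u0"] fU[OF u0(1)] u0(2) U'(2) by auto
  finally have "c > 0"
    using h_pos[of u0] u0(1) U(2) \<open>u0 \<noteq> 0\<close> by (auto simp: zero_less_mult_iff)
  \<comment> \<open>\<open>f\<close> multiplies every form by \<open>c\<close>, which is positive by
    comparing \<open>u0\<close> with \<open>f u0\<close> under \<open>h x0\<close>. The factor
    \<open>1 / sqrt c\<close> therefore makes \<open>f\<close> an isometry, and the same multiple of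
    \<open>g\<close> is its inverse.\<close>
  define s where "s = complex_of_real (inverse (sqrt c))"
  have s: "s * s * of_real c = 1" "cnj s = s"
  proof -
    have "inverse (sqrt c) * inverse (sqrt c) * c = 1"
      using \<open>c > 0\<close> by (metis inverse_mult_distrib left_inverse less_imp_neq order_less_imp_le
          real_sqrt_mult_self abs_of_nonneg)
    then show "s * s * of_real c = 1" unfolding s_def by (metis of_real_1 of_real_mult)
  qed (simp add: s_def)
  have "clinear_on U U' (\<lambda>u. s *\<^sub>C f u)"
    unfolding clinear_on_def using fU U'(1)
    by (auto simp: clinear_onD(2,3)[OF f] complex_vector.scale_right_distrib mult.commute
        intro: complex_vector.subspace_scale)
  moreover have "bij_betw (\<lambda>u. s *\<^sub>C f u) U U'"
  proof (rule bij_betw_byWitness[where f' = "\<lambda>u. s *\<^sub>C g u"])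
    show "\<forall>u\<in>U. s *\<^sub>C g (s *\<^sub>C f u) = u"
      using s(1) by (auto simp: clinear_onD(3)[OF g] fU c mult.assoc)
    show "\<forall>u\<in>U'. s *\<^sub>C f (s *\<^sub>C g u) = u"
      using s(1) by (auto simp: clinear_onD(3)[OF f] gU d dc mult.assoc)
  qed (use fU gU U(1) U'(1) in \<open>auto intro: complex_vector.subspace_scale\<close>)
  moreover have "h x (s *\<^sub>C f u) (s *\<^sub>C f v) = h x u v" if "x \<in> X" "u \<in> U" "v \<in> U" for x u v
  proof -
    have "f u \<in> V" "f v \<in> V" using that fU U'(2) by auto
    then have "h x (s *\<^sub>C f u) (s *\<^sub>C f v) = s * s * h x (f u) (f v)"
      using that s(2) by (simp add: h_scale_left h_scale_right V_closed)
    also have "\<dots> = (s * s * of_real c) * h x u v" using hff[OF that] by simp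
    finally show ?thesis using s(1) by simp
  qed
  ultimately show ?thesis unfolding isometric_def by blast
qed

section \<open>Orthogonal decompositions and multiplicities\<close>

definition form_decomposition :: "'i set \<Rightarrow> ('i \<Rightarrow> 'a set) \<Rightarrow> bool" where
  "form_decomposition I U \<longleftrightarrow> finite I \<and>
     (\<forall>i\<in>I. complex_vector.subspace (U i) \<and> U i \<subseteq> V) \<and>
     (\<forall>i\<in>I. \<forall>k\<in>I. i \<noteq> k \<longrightarrow> (\<forall>x\<in>X. \<forall>u\<in>U i. \<forall>v\<in>U k. h x u v = 0)) \<and>
     (\<forall>v\<in>V. \<exists>c. (\<forall>i\<in>I. c i \<in> U i) \<and> v = (\<Sum>i\<in>I. c i))"

lemma form_decompositionD:
  assumes "form_decomposition I U"
  shows "finite I"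
    and "\<And>i. i \<in> I \<Longrightarrow> complex_vector.subspace (U i)"
    and "\<And>i. i \<in> I \<Longrightarrow> U i \<subseteq> V"
    and "\<And>i k x u v. i \<in> I \<Longrightarrow> k \<in> I \<Longrightarrow> i \<noteq> k \<Longrightarrow> x \<in> X \<Longrightarrow> u \<in> U i \<Longrightarrow> v \<in> U k \<Longrightarrow> h x u v = 0"
    and "\<And>v. v \<in> V \<Longrightarrow> \<exists>c. (\<forall>i\<in>I. c i \<in> U i) \<and> v = (\<Sum>i\<in>I. c i)"
  using assms by (auto simp: form_decomposition_def)

text \<open>The projection for \<open>h x0\<close> onto a summand is the component map, and the
  component map does not depend on the form. Since the summands are orthogonal for every
  \<open>h x\<close>, it satisfies the projection identity for all of them, degenerate ones
  included.\<close>

lemma form_decomposition_projections: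
  assumes D: "form_decomposition I U"
  shows "\<exists>P. (\<forall>i\<in>I. clinear_on V (U i) (P i)) \<and> (\<forall>v\<in>V. v = (\<Sum>i\<in>I. P i v)) \<and>
    (\<forall>i\<in>I. \<forall>x\<in>X. \<forall>v\<in>V. \<forall>w\<in>U i. h x (P i v) w = h x v w)"
proof -
  note fin = form_decompositionD(1)[OF D] and U = form_decompositionD(2,3)[OF D]
    and orth = form_decompositionD(4)[OF D] and dec = form_decompositionD(5)[OF D]
  have "\<forall>i\<in>I. \<exists>Q. clinear_on V (U i) Q \<and> (\<forall>v\<in>V. \<forall>w\<in>U i. h x0 (Q v) w = h x0 v w)"
    using projection_exists U by blast
  then obtain P where P: "\<And>i. i \<in> I \<Longrightarrow> clinear_on V (U i) (P i)"
    "\<And>i v w. i \<in> I \<Longrightarrow> v \<in> V \<Longrightarrow> w \<in> U i \<Longrightarrow> h x0 (P i v) w = h x0 v w"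
    by (auto simp: bchoice_iff)
  have component: "h x (\<Sum>k\<in>I. c k) w = h x (c i) w"
    if "\<And>i. i \<in> I \<Longrightarrow> c i \<in> U i" "i \<in> I" "x \<in> X" "w \<in> U i" for c i x w
  proof -
    have "h x (\<Sum>k\<in>I. c k) w = (\<Sum>k\<in>I. h x (c k) w)"
      by (rule h_sum_left) (use that U(2) in auto)
    also have "\<dots> = (\<Sum>k\<in>I. if k = i then h x (c i) w else 0)"
      by (rule sum.cong) (use that orth in auto)
    finally show ?thesis using fin that by simp
  qed
  have P_eq: "P i (\<Sum>k\<in>I. c k) = c i" if c: "\<And>i. i \<in> I \<Longrightarrow> c i \<in> U i" and i: "i \<in> I" for c i
  proof (rule h_eqI[OF U(1)[OF i] U(2)[OF i]])
    have sV: "(\<Sum>k\<in>I. c k) \<in> V" using c U(2) by (intro V_closed) blast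
    then show "P i (\<Sum>k\<in>I. c k) \<in> U i" using clinear_onD(1)[OF P(1)[OF i]] by blast
    show "h x0 (P i (\<Sum>k\<in>I. c k)) w = h x0 (c i) w" if "w \<in> U i" for w
      using P(2)[OF i sV that] component[OF c i x0 that] by simp
  qed (use c i in auto)
  have "v = (\<Sum>i\<in>I. P i v)" "\<forall>i\<in>I. \<forall>x\<in>X. \<forall>w\<in>U i. h x (P i v) w = h x v w" if v: "v \<in> V" for v
  proof -
    obtain c where c: "\<And>i. i \<in> I \<Longrightarrow> c i \<in> U i" "v = (\<Sum>i\<in>I. c i)" using dec[OF v] by blast
    have Pc: "P i v = c i" if "i \<in> I" for i using P_eq[OF c(1) that] c(2) by simp
    then show "v = (\<Sum>i\<in>I. P i v)" using c(2) by simp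
    show "\<forall>i\<in>I. \<forall>x\<in>X. \<forall>w\<in>U i. h x (P i v) w = h x v w"
      using component[OF c(1)] c(2) Pc by simp
  qed
  then show ?thesis using P(1) by (intro exI[of _ P]) blast
qed

text \<open>Dimension is counted by orthonormal vectors for \<open>h x0\<close>: each summand
  isometric to \<open>R\<close> contributes exactly \<open>card E0\<close> of them, and
  orthogonality keeps the contributions disjoint. Those from the first decomposition lie in the span
  of those from the second, and the positive factor \<open>card E0\<close> cancels. The hypotheses
  are symmetric, so exchanging the decompositions gives the converse inequality.\<close>

lemma card_isometric_le:
  assumes D: "form_decomposition I U" and D': "form_decomposition I' U'"
    and irr: "\<And>i. i \<in> I \<Longrightarrow> form_irreducible X h (U i)"
    and irr': "\<And>k. k \<in> I' \<Longrightarrow> form_irreducible X h (U' k)"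
    and R: "complex_vector.subspace R" "R \<subseteq> V" "R \<noteq> {0}"
  shows "card {i \<in> I. isometric R (U i)} \<le> card {k \<in> I'. isometric R (U' k)}"
proof -
  note U = form_decompositionD(2,3)[OF D] and U' = form_decompositionD(2,3)[OF D']
  let ?C = "{i \<in> I. isometric R (U i)}" and ?D = "{k \<in> I'. isometric R (U' k)}"
  obtain E0 where E0: "orthonormal E0" "complex_vector.span E0 = R"
    using orthonormal_basis_exists[OF R(1,2)] by blast
  have E0R: "E0 \<subseteq> R" using E0(2) complex_vector.span_superset by blast
  have "E0 \<noteq> {}" using E0(2) R(3) by auto
  then have pos: "card E0 > 0" using E0(1) by (auto simp: orthonormal_def card_gt_0_iff)
  have basis: "\<exists>E. orthonormal E \<and> complex_vector.span E = B \<and> card E = card E0"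
    if B: "complex_vector.subspace B" "B \<subseteq> V" and iso: "isometric R B" for B
  proof -
    obtain f where f: "clinear_on R B f" "bij_betw f R B"
      "\<And>x u v. x \<in> X \<Longrightarrow> u \<in> R \<Longrightarrow> v \<in> R \<Longrightarrow> h x (f u) (f v) = h x u v"
      using iso by (auto simp: isometric_def)
    have inj: "inj_on f E0" using f(2) E0R by (auto simp: bij_betw_def intro: inj_on_subset)
    have fB: "f ` E0 \<subseteq> B" using clinear_onD(1)[OF f(1)] E0R by auto
    have "orthonormal (f ` E0)"
      unfolding orthonormal_def
    proof (intro conjI ballI impI)
      show "finite (f ` E0)" "f ` E0 \<subseteq> V" using E0(1) fB B(2) by (auto simp: orthonormal_def)
    next
      fix d assume "d \<in> f ` E0"
      then obtain e where "e \<in> E0" "d = f e" by blast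
      then show "h x0 d d = 1" using f(3)[OF x0, of e e] E0(1) E0R by (auto simp: orthonormal_def)
    next
      fix d d' assume "d \<in> f ` E0" "d' \<in> f ` E0" "d \<noteq> d'"
      then obtain e e' where "e \<in> E0" "d = f e" "e' \<in> E0" "d' = f e'" "e \<noteq> e'" by blast
      then show "h x0 d d' = 0"
        using f(3)[OF x0, of e e'] E0(1) E0R by (auto simp: orthonormal_def)
    qed
    moreover have "complex_vector.span (f ` E0) = B"
    proof
      show "complex_vector.span (f ` E0) \<subseteq> B" using fB B(1) by (rule complex_vector.span_minimal)
      show "B \<subseteq> complex_vector.span (f ` E0)"
      proof
        fix b assume "b \<in> B"
        then obtain r where r: "r \<in> R" "b = f r" using f(2) by (auto simp: bij_betw_def)
        have "r \<in> complex_vector.span E0" using r E0(2) by simp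
        then have "r \<in> R \<and> f r \<in> complex_vector.span (f ` E0)"
        proof (induction rule: complex_vector.span_induct_alt)
          case base
          show ?case
            using clinear_on_zero[OF f(1) R(1)] R(1) by (simp add: complex_vector.subspace_0 complex_vector.span_zero)
        next
          case (step c e w)
          have e: "e \<in> R" using step E0R by auto
          show ?case
            using step e R(1)
            by (simp add: clinear_onD[OF f(1)] complex_vector.subspace_add complex_vector.subspace_scale
                complex_vector.span_add complex_vector.span_scale complex_vector.span_base)
        qed
        then show "b \<in> complex_vector.span (f ` E0)" using r by simp
      qed
    qed
    ultimately show ?thesis using inj card_image by blast
  qed
  have union: "orthonormal (\<Union>i\<in>J. E i) \<and> card (\<Union>i\<in>J. E i) = card J * card E0"
    if DJ: "form_decomposition K T" "J \<subseteq> K"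
      and E: "\<And>i. i \<in> J \<Longrightarrow> orthonormal (E i)" "\<And>i. i \<in> J \<Longrightarrow> complex_vector.span (E i) = T i"
        "\<And>i. i \<in> J \<Longrightarrow> card (E i) = card E0" for K J :: "'z set" and T E
  proof -
    have ET: "e \<in> T i" if "i \<in> J" "e \<in> E i" for i e
      using E(2)[OF that(1)] that(2) complex_vector.span_base by blast
    have orth: "h x0 e f = 0" if "i \<in> J" "k \<in> J" "i \<noteq> k" "e \<in> E i" "f \<in> E k" for i k e f
      using form_decompositionD(4)[OF DJ(1), of i k x0 e f] DJ(2) that ET x0 by blast
    have fJ: "finite J" using form_decompositionD(1)[OF DJ(1)] DJ(2) by (rule finite_subset[rotated])
    have "orthonormal (\<Union>i\<in>J. E i)"
      unfolding orthonormal_def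
    proof (intro conjI ballI impI)
      fix e f assume ef: "e \<in> (\<Union>i\<in>J. E i)" "f \<in> (\<Union>i\<in>J. E i)" "e \<noteq> f"
      then obtain i k where ik: "i \<in> J" "e \<in> E i" "k \<in> J" "f \<in> E k" by blast
      then show "h x0 e f = 0"
        using orth[of i k e f] E(1)[of i] ef(3) unfolding orthonormal_def by blast
    next
      show "(\<Union>i\<in>J. E i) \<subseteq> V" using E(1) by (intro UN_least) (simp add: orthonormal_def)
    qed (use fJ E(1) in \<open>auto simp: orthonormal_def\<close>)
    moreover have "card (\<Union>i\<in>J. E i) = (\<Sum>i\<in>J. card (E i))"
    proof (rule card_UN_disjoint[OF fJ])
      show "\<forall>i\<in>J. finite (E i)" using E(1) by (auto simp: orthonormal_def)
      show "\<forall>i\<in>J. \<forall>k\<in>J. i \<noteq> k \<longrightarrow> E i \<inter> E k = {}"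
      proof (intro ballI impI equals0I)
        fix i k e assume ik: "i \<in> J" "k \<in> J" "i \<noteq> k" "e \<in> E i \<inter> E k"
        then have "h x0 e e = 1" "h x0 e e = 0"
          using E(1)[of i] orth[of i k e e] by (auto simp: orthonormal_def)
        then show False by simp
      qed
    qed
    ultimately show ?thesis using E(3) by simp
  qed
  have "\<forall>i\<in>?C. \<exists>E. orthonormal E \<and> complex_vector.span E = U i \<and> card E = card E0"
    using basis U by blast
  then obtain E where E: "\<And>i. i \<in> ?C \<Longrightarrow> orthonormal (E i)"
    "\<And>i. i \<in> ?C \<Longrightarrow> complex_vector.span (E i) = U i" "\<And>i. i \<in> ?C \<Longrightarrow> card (E i) = card E0"
    unfolding bchoice_iff by blast
  have "\<forall>k\<in>?D. \<exists>E. orthonormal E \<and> complex_vector.span E = U' k \<and> card E = card E0"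
    using basis U' by blast
  then obtain E' where E': "\<And>k. k \<in> ?D \<Longrightarrow> orthonormal (E' k)"
    "\<And>k. k \<in> ?D \<Longrightarrow> complex_vector.span (E' k) = U' k" "\<And>k. k \<in> ?D \<Longrightarrow> card (E' k) = card E0"
    unfolding bchoice_iff by blast
  have oE: "orthonormal (\<Union>i\<in>?C. E i) \<and> card (\<Union>i\<in>?C. E i) = card ?C * card E0"
    by (rule union[OF D]) (use E in auto)
  have oE': "orthonormal (\<Union>k\<in>?D. E' k) \<and> card (\<Union>k\<in>?D. E' k) = card ?D * card E0"
    by (rule union[OF D']) (use E' in auto)
  obtain P where P: "\<And>i. i \<in> I \<Longrightarrow> clinear_on V (U i) (P i)"
    "\<And>i x v w. i \<in> I \<Longrightarrow> x \<in> X \<Longrightarrow> v \<in> V \<Longrightarrow> w \<in> U i \<Longrightarrow> h x (P i v) w = h x v w"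
    using form_decomposition_projections[OF D] by blast
  obtain P' where P': "\<And>k. k \<in> I' \<Longrightarrow> clinear_on V (U' k) (P' k)"
    "\<And>v. v \<in> V \<Longrightarrow> v = (\<Sum>k\<in>I'. P' k v)"
    "\<And>k x v w. k \<in> I' \<Longrightarrow> x \<in> X \<Longrightarrow> v \<in> V \<Longrightarrow> w \<in> U' k \<Longrightarrow> h x (P' k v) w = h x v w"
    using form_decomposition_projections[OF D'] by blast
  have restrict: "clinear_on A B f" if "clinear_on V B f" "A \<subseteq> V" for A B and f :: "'a \<Rightarrow> 'a"
    using that unfolding clinear_on_def by blast
  \<comment> \<open>A nonzero component of \<open>u\<close> in \<open>U' k\<close> would, by Schur's
    lemma, make \<open>U i\<close> isometric to \<open>U' k\<close>, and transitivity would put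
    \<open>k\<close> in the class of \<open>R\<close>.\<close>
  have zero: "P' k u = 0" if i: "i \<in> ?C" and k: "k \<in> I'" "k \<notin> ?D" and u: "u \<in> U i" for i k u
  proof (rule ccontr)
    assume nz: "P' k u \<noteq> 0"
    have iI: "i \<in> I" using i by simp
    \<comment> \<open>Between \<open>U i\<close> and \<open>U' k\<close> the projections of the two
      decompositions are adjoint for every form: both sides equal \<open>h x u v\<close>.\<close>
    have adj: "h x (P' k u) v = h x u (P i v)" if x: "x \<in> X" and uv: "u \<in> U i" "v \<in> U' k" for x u v
    proof -
      have V: "u \<in> V" "v \<in> V" using U(2)[OF iI] U'(2)[OF k(1)] uv by auto
      then have PV: "P i v \<in> V" using clinear_onD(1)[OF P(1)[OF iI]] U(2)[OF iI] by blast
      have "h x u (P i v) = cnj (h x v u)"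
        using P(2)[OF iI x V(2) uv(1)] h_commute[OF x V(1) PV] by simp
      also have "\<dots> = h x u v" using h_commute[OF x V] by simp
      finally show ?thesis using P'(3)[OF k(1) x V(1) uv(2)] by simp
    qed
    have "isometric (U i) (U' k)"
      by (rule schur[OF U(1)[OF iI] U(2)[OF iI] irr[OF iI] U'(1)[OF k(1)] U'(2)[OF k(1)] irr'[OF k(1)]
            restrict[OF P'(1)[OF k(1)] U(2)[OF iI]] restrict[OF P(1)[OF iI] U'(2)[OF k(1)]]
            adj u nz])
    then show False using i k isometric_trans by blast
  qed
  have "(\<Union>i\<in>?C. E i) \<subseteq> complex_vector.span (\<Union>k\<in>?D. E' k)"
  proof
    fix e assume "e \<in> (\<Union>i\<in>?C. E i)"
    then obtain i where i: "i \<in> ?C" "e \<in> E i" by blast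
    then have e: "e \<in> U i" using E(2) complex_vector.span_base by blast
    then have eV: "e \<in> V" using i U(2) by blast
    have "P' k e \<in> complex_vector.span (\<Union>k\<in>?D. E' k)" if k: "k \<in> I'" for k
    proof (cases "k \<in> ?D")
      case True
      have "P' k e \<in> complex_vector.span (E' k)"
        using clinear_onD(1)[OF P'(1)[OF k] eV] E'(2)[OF True] by simp
      then show ?thesis using complex_vector.span_mono[of "E' k" "\<Union>k\<in>?D. E' k"] True by blast
    next
      case False
      then show ?thesis using zero[OF i(1) k _ e] complex_vector.span_zero by metis
    qed
    then have "(\<Sum>k\<in>I'. P' k e) \<in> complex_vector.span (\<Union>k\<in>?D. E' k)"
      by (rule complex_vector.span_sum)
    then show "e \<in> complex_vector.span (\<Union>k\<in>?D. E' k)" using P'(2)[OF eV] by simp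
  qed
  then have "card (\<Union>i\<in>?C. E i) \<le> card (\<Union>k\<in>?D. E' k)"
    using orthonormal_card_le oE oE' by blast
  then show ?thesis using oE oE' pos by simp
qed

theorem krull_schmidt:
  fixes j j' :: nat
  assumes D: "form_decomposition {1..j} U" and D': "form_decomposition {1..j'} U'"
    and irr: "\<And>i. i \<in> {1..j} \<Longrightarrow> form_irreducible X h (U i)" "\<And>i. i \<in> {1..j} \<Longrightarrow> U i \<noteq> {0}"
    and irr': "\<And>k. k \<in> {1..j'} \<Longrightarrow> form_irreducible X h (U' k)" "\<And>k. k \<in> {1..j'} \<Longrightarrow> U' k \<noteq> {0}"
  shows "j = j' \<and> (\<exists>\<sigma>. \<sigma> permutes {1..j} \<and> (\<forall>i\<in>{1..j}. isometric (U i) (U' (\<sigma> i))))"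
proof -
  note U = form_decompositionD(2,3)[OF D] and U' = form_decompositionD(2,3)[OF D']
  have eq: "card {i \<in> {1..j}. isometric R (U i)} = card {k \<in> {1..j'}. isometric R (U' k)}"
    if "complex_vector.subspace R" "R \<subseteq> V" "R \<noteq> {0}" for R
    using card_isometric_le[OF D D' irr(1) irr'(1) that] card_isometric_le[OF D' D irr'(1) irr(1) that]
    by (rule antisym)
  \<comment> \<open>Isometry classes serve as labels, so that comparing summands of the two
    decompositions becomes comparing the values of two functions, as the extraction of a permutation
    requires.\<close>
  define cls where "cls A = {B. isometric A B}" for A
  have cls: "cls A = cls B \<longleftrightarrow> isometric B A"
    if "complex_vector.subspace A" "complex_vector.subspace B" for A B
    unfolding cls_def using isometric_refl isometric_sym isometric_trans that by blast
  let ?f = "\<lambda>i. cls (U i)" and ?f' = "\<lambda>k. cls (U' k)"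
  have counts: "card {i \<in> {1..j}. ?f i = z} = card {k \<in> {1..j'}. ?f' k = z}" for z
  proof (cases "\<exists>R. complex_vector.subspace R \<and> R \<subseteq> V \<and> R \<noteq> {0} \<and> z = cls R")
    case True
    then obtain R where R: "complex_vector.subspace R" "R \<subseteq> V" "R \<noteq> {0}" "z = cls R" by blast
    have "{i \<in> {1..j}. ?f i = z} = {i \<in> {1..j}. isometric R (U i)}"
      "{k \<in> {1..j'}. ?f' k = z} = {k \<in> {1..j'}. isometric R (U' k)}"
      using cls[OF U(1) R(1)] cls[OF U'(1) R(1)] R(4) by blast+
    then show ?thesis using eq R by simp
  next
    \<comment> \<open>A set that is not the class of a nonzero subspace of \<open>V\<close> is the
      label of no summand, so both fibres are empty.\<close>
    case False
    then have none: "z \<noteq> cls R" if "complex_vector.subspace R" "R \<subseteq> V" "R \<noteq> {0}" for R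
      using that by blast
    have "z \<noteq> ?f i" if "i \<in> {1..j}" for i by (rule none[OF U(1,2) irr(2), OF that that that])
    moreover have "z \<noteq> ?f' k" if "k \<in> {1..j'}" for k
      by (rule none[OF U'(1,2) irr'(2), OF that that that])
    ultimately have empty: "{i \<in> {1..j}. ?f i = z} = {}" "{k \<in> {1..j'}. ?f' k = z} = {}"
      by fast+
    show ?thesis unfolding empty ..
  qed
  have mset: "image_mset ?f (mset_set {1..j}) = image_mset ?f' (mset_set {1..j'})"
  proof (rule multiset_eqI)
    fix z
    show "count (image_mset ?f (mset_set {1..j})) z = count (image_mset ?f' (mset_set {1..j'})) z"
      unfolding count_image_mset_set[OF finite_atLeastAtMost] by (rule counts)
  qed
  have "size (mset_set {1..j}) = size (mset_set {1..j'})"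
    by (rule arg_cong[OF mset, of size, unfolded size_image_mset])
  then have jj: "j = j'" by simp
  obtain \<sigma> where \<sigma>: "\<sigma> permutes {1..j}" "\<forall>i\<in>{1..j}. ?f i = ?f' (\<sigma> i)"
    by (rule image_mset_eq_implies_permutes[OF _ mset[folded jj]]) simp
  have "isometric (U i) (U' (\<sigma> i))" if i: "i \<in> {1..j}" for i
  proof -
    have "\<sigma> i \<in> {1..j'}" using i unfolding jj[symmetric] permutes_in_image[OF \<sigma>(1)] .
    then show ?thesis using cls[OF U'(1) U(1)[OF i]] \<sigma>(2)[rule_format, OF i] by blast
  qed
  then show ?thesis using jj \<sigma>(1) by blast
qed

end

section \<open>Transport along isometries\<close>

text \<open>Needed because a summand weight \<open>Ws i\<close> is known to agree with
  \<open>W\<close> only on \<open>Vs i\<close>.\<close>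

lemma form_irreducible_cong:
  assumes "form_irreducible X h U"
    and "\<And>x u v. x \<in> X \<Longrightarrow> u \<in> U \<Longrightarrow> v \<in> U \<Longrightarrow> h x u v = h' x u v"
  shows "form_irreducible X h' U"
  unfolding form_irreducible_def
proof (intro allI impI, elim conjE)
  fix A B
  assume AB: "complex_vector.subspace A" "complex_vector.subspace B" "A \<subseteq> U" "B \<subseteq> U"
    "\<forall>u\<in>U. \<exists>p\<in>A. \<exists>q\<in>B. u = p + q" and 0: "\<forall>x\<in>X. \<forall>p\<in>A. \<forall>q\<in>B. h' x p q = 0"
  have "h x p q = 0" if "x \<in> X" "p \<in> A" "q \<in> B" for x p q
    using assms(2)[of x p q] 0 that AB(3,4) by (metis subsetD)
  then show "A = {0} \<or> B = {0}"
    by (intro assms(1)[unfolded form_irreducible_def, rule_format] conjI AB) blast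
qed

text \<open>A splitting of the image pulls back along \<open>R\<close> to a splitting of
  \<open>U\<close>; a part whose preimage is zero is itself zero because \<open>R\<close> is
  onto.\<close>

lemma form_irreducible_image:
  assumes R: "clinear_on U V R" "bij_betw R U V" and U: "complex_vector.subspace U"
    and irr: "form_irreducible X h' U"
    and iso: "\<And>x u v. x \<in> X \<Longrightarrow> u \<in> U \<Longrightarrow> v \<in> U \<Longrightarrow> h' x u v = h x (R u) (R v)"
  shows "form_irreducible X h V"
  unfolding form_irreducible_def
proof (intro allI impI, elim conjE)
  fix A B
  assume A: "complex_vector.subspace A" "A \<subseteq> V" and B: "complex_vector.subspace B" "B \<subseteq> V"
    and split: "\<forall>u\<in>V. \<exists>p\<in>A. \<exists>q\<in>B. u = p + q" and orth: "\<forall>x\<in>X. \<forall>p\<in>A. \<forall>q\<in>B. h x p q = 0"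
  define pre where "pre C = {u \<in> U. R u \<in> C}" for C
  have R0: "R 0 = 0" by (rule clinear_on_zero[OF R(1) U])
  have inj: "u = v" if "u \<in> U" "v \<in> U" "R u = R v" for u v
    using R(2) that by (auto simp: bij_betw_def inj_on_def)
  have surj: "\<exists>u\<in>U. R u = v" if "v \<in> V" for v using R(2) that by (auto simp: bij_betw_def)
  have sub: "complex_vector.subspace (pre C)" if "complex_vector.subspace C" for C
    unfolding pre_def
    using that U R0 by (auto intro!: complex_vector.subspaceI
        simp: clinear_onD[OF R(1)] complex_vector.subspace_0 complex_vector.subspace_add
          complex_vector.subspace_scale)
  have "\<exists>p\<in>pre A. \<exists>q\<in>pre B. u = p + q" if u: "u \<in> U" for u
  proof -
    obtain p q where pq: "p \<in> A" "q \<in> B" "R u = p + q"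
      using split clinear_onD(1)[OF R(1) u] by blast
    obtain p' where p': "p' \<in> U" "R p' = p" using surj pq A by blast
    obtain q' where q': "q' \<in> U" "R q' = q" using surj pq B by blast
    have "u = p' + q'"
      using inj[OF u, of "p' + q'"] p' q' pq clinear_onD(2)[OF R(1)] complex_vector.subspace_add[OF U]
      by simp
    then show ?thesis using p' q' pq by (auto simp: pre_def)
  qed
  moreover have "h' x p q = 0" if "x \<in> X" "p \<in> pre A" "q \<in> pre B" for x p q
    using orth that iso by (simp add: pre_def)
  moreover have "pre C \<subseteq> U" for C by (auto simp: pre_def)
  ultimately have "pre A = {0} \<or> pre B = {0}"
    using irr sub[OF A(1)] sub[OF B(1)] unfolding form_irreducible_def by blast
  moreover have pre_zero: "C = {0}"
    if C: "complex_vector.subspace C" "C \<subseteq> V" and "pre C = {0}" for C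
  proof -
    have "C \<subseteq> {0}"
    proof
      fix c assume "c \<in> C"
      obtain u where "u \<in> U" "R u = c" using surj \<open>c \<in> C\<close> C(2) by blast
      then have "u \<in> pre C" using \<open>c \<in> C\<close> by (simp add: pre_def)
      then show "c \<in> {0}" using \<open>pre C = {0}\<close> \<open>R u = c\<close> R0 by simp
    qed
    then show ?thesis using complex_vector.subspace_0[OF C(1)] by blast
  qed
  ultimately show "A = {0} \<or> B = {0}" using pre_zero[OF A] pre_zero[OF B] by argo
qed

text \<open>Moves the second decomposition into the space of the first, since multiplicities are
  compared for two decompositions of one space.\<close>

lemma form_decomposition_image:
  assumes "form_space V X h x0" "form_space V' X h' x0'"
    and R: "clinear_on V' V R" "bij_betw R V' V"
    and iso: "\<And>x u v. x \<in> X \<Longrightarrow> u \<in> V' \<Longrightarrow> v \<in> V' \<Longrightarrow> h' x u v = h x (R u) (R v)"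
    and D: "form_space.form_decomposition V' X h' I U"
  shows "form_space.form_decomposition V X h I (\<lambda>i. R ` U i)"
proof -
  interpret T: form_space V X h x0 by fact
  interpret S: form_space V' X h' x0' by fact
  note DD = S.form_decompositionD[OF D]
  have R_res: "clinear_on (U i) V R" if "i \<in> I" for i
    using R(1) DD(3)[OF that] unfolding clinear_on_def by blast
  show ?thesis
    unfolding T.form_decomposition_def
  proof (intro conjI ballI impI)
    show "finite I" by (rule DD(1))
  next
    fix i assume i: "i \<in> I"
    show "complex_vector.subspace (R ` U i)" by (rule subspace_image_clinear_on[OF R_res[OF i] DD(2)[OF i]])
    show "R ` U i \<subseteq> V" using clinear_onD(1)[OF R_res[OF i]] by blast
  next
    fix i k x u v
    assume ik: "i \<in> I" "k \<in> I" "i \<noteq> k" and x: "x \<in> X" and uv: "u \<in> R ` U i" "v \<in> R ` U k"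
    then obtain p q where pq: "p \<in> U i" "q \<in> U k" "u = R p" "v = R q" by blast
    then have "p \<in> V'" "q \<in> V'" using DD(3) ik by blast+
    then show "h x u v = 0" using DD(4)[OF ik x pq(1,2)] iso[OF x] pq by simp
  next
    fix v assume "v \<in> V"
    then obtain u where u: "u \<in> V'" "v = R u" using R(2) by (auto simp: bij_betw_def)
    obtain c where c: "\<forall>i\<in>I. c i \<in> U i" "u = (\<Sum>i\<in>I. c i)" using DD(5)[OF u(1)] by blast
    have "v = (\<Sum>i\<in>I. R (c i))"
      unfolding u(2) c(2)
      by (rule clinear_on_sum[OF R(1) S.subspace]) (use c DD(3) in blast)
    then show "\<exists>c. (\<forall>i\<in>I. c i \<in> R ` U i) \<and> v = (\<Sum>i\<in>I. c i)"
      using c(1) by (intro exI[of _ "\<lambda>i. R (c i)"]) auto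
  qed
qed

section \<open>Operator weights and their forms\<close>

text \<open>With a one-point index set, orthonormal bases and projections become available for
  \<open>cinner\<close> itself.\<close>

lemma form_space_cinner:
  assumes "findim_space V"
  shows "form_space V UNIV (\<lambda>_::unit. cinner) ()"
proof
  fix v :: 'a assume "v \<noteq> 0"
  then have "cinner v v \<noteq> 0" by (simp add: cinner_eq_zero_iff)
  moreover have "Im (cinner v v) = 0"
    using cinner_commute[of v v] by (simp add: complex_eq_iff)
  ultimately show "0 < Re (cinner v v)"
    using cinner_ge_zero[of v] by (auto simp: complex_eq_iff)
qed (use assms in \<open>auto simp: cinner_add_left cinner_scaleC_left intro: cinner_commute\<close>)

lemma cinner_eqI:
  assumes V: "findim_space V" and "u \<in> V" "v \<in> V" "\<And>w. w \<in> V \<Longrightarrow> cinner u w = cinner v w"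
  shows "u = v"
proof -
  interpret form_space V UNIV "\<lambda>_::unit. cinner" "()" by (rule form_space_cinner[OF V])
  show ?thesis by (rule h_eqI[OF subspace]) (use assms in auto)
qed

text \<open>The adjunction forces the coefficients of \<open>T v\<close> in an orthonormal basis
  \<open>E\<close> of \<open>V'\<close> to be \<open>cinner v (R e)\<close>, and these define
  \<open>T\<close>.\<close>

lemma adjoint_exists:
  assumes V: "findim_space V" and V': "findim_space V'" and R: "clinear_on V' V R"
  shows "\<exists>T. clinear_on V V' T \<and> (\<forall>v\<in>V. \<forall>w\<in>V'. cinner (T v) w = cinner v (R w))"
proof -
  interpret S: form_space V UNIV "\<lambda>_::unit. cinner" "()" by (rule form_space_cinner[OF V])
  interpret S': form_space V' UNIV "\<lambda>_::unit. cinner" "()" by (rule form_space_cinner[OF V'])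
  obtain E where E: "S'.orthonormal E" "complex_vector.span E = V'"
    using S'.orthonormal_basis_exists[OF S'.subspace order_refl] by blast
  have EV: "e \<in> V'" if "e \<in> E" for e using E(2) that complex_vector.span_base by blast
  define T where "T v = (\<Sum>e\<in>E. cinner v (R e) *\<^sub>C e)" for v
  have TV: "T v \<in> V'" for v unfolding T_def by (intro S'.V_closed EV)
  have "clinear_on V V' T"
    unfolding clinear_on_def using TV
    by (auto simp: T_def cinner_add_left cinner_scaleC_left complex_vector.scale_left_distrib
        sum.distrib complex_vector.scale_sum_right)
  moreover have "cinner (T v) w = cinner v (R w)" if v: "v \<in> V" and w: "w \<in> V'" for v w
  proof -
    have "w \<in> complex_vector.span E" using w E(2) by simp
    then have "w \<in> V' \<and> cinner (T v) w = cinner v (R w)"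
    proof (induction rule: complex_vector.span_induct_alt)
      case base
      show ?case
        using S'.h_zero_right[OF UNIV_I TV] S.h_zero_right[OF UNIV_I v] clinear_on_zero[OF R S'.subspace]
        by (simp add: S'.V_closed)
    next
      case (step c e w)
      have e: "e \<in> V'" "cinner (T v) e = cinner v (R e)"
        using EV step S'.orthonormal_coefficient[OF E(1)] by (auto simp: T_def)
      have "cinner (T v) (c *\<^sub>C e + w) = cnj c * cinner (T v) e + cinner (T v) w"
        using S'.h_add_right S'.h_scale_right e step TV by (simp add: S'.V_closed)
      also have "\<dots> = cinner v (R (c *\<^sub>C e + w))"
        using S.h_add_right S.h_scale_right e step v
        by (simp add: clinear_onD[OF R] S.V_closed S'.V_closed)
      finally show ?case using e step by (simp add: S'.V_closed)
    qed
    then show ?thesis by simp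
  qed
  ultimately show ?thesis by blast
qed

text \<open>The adjoint \<open>S\<close> of the inverse of \<open>R\<close> is inverse to
  \<open>T\<close>: taking adjoints reverses products, and inner products separate vectors.\<close>

lemma adjoint_bij:
  assumes V: "findim_space V" and V': "findim_space V'"
    and R: "clinear_on V' V R" "bij_betw R V' V"
    and T: "clinear_on V V' T"
    and adj: "\<And>v w. v \<in> V \<Longrightarrow> w \<in> V' \<Longrightarrow> cinner (T v) w = cinner v (R w)"
  shows "bij_betw T V V'"
proof -
  note sV = findim_space_subspace[OF V] and sV' = findim_space_subspace[OF V']
  let ?G = "inv_into V' R"
  have G: "clinear_on V V' ?G" by (rule clinear_on_inv_into[OF R sV'])
  have RG: "R (?G v) = v" "?G v \<in> V'" if "v \<in> V" for v
    using R(2) that by (auto simp: bij_betw_def f_inv_into_f inv_into_into)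
  have GR: "?G (R w) = w" if "w \<in> V'" for w using R(2) that by (auto simp: bij_betw_def)
  obtain S where S: "clinear_on V' V S"
    and adjS: "\<And>v w. v \<in> V' \<Longrightarrow> w \<in> V \<Longrightarrow> cinner (S v) w = cinner v (?G w)"
    using adjoint_exists[OF V' V G] by blast
  have "T (S w) = w" if w: "w \<in> V'" for w
    using w clinear_onD(1)[OF S w] clinear_onD(1)[OF T] clinear_onD(1)[OF R(1)] adj adjS GR
    by (intro cinner_eqI[OF V']) auto
  moreover have "S (T v) = v" if v: "v \<in> V" for v
    using v clinear_onD(1)[OF T v] clinear_onD(1)[OF S] adj adjS RG
    by (intro cinner_eqI[OF V]) auto
  ultimately show ?thesis
    using clinear_onD(1)[OF S] clinear_onD(1)[OF T]
    by (intro bij_betw_byWitness[where f' = S]) auto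
qed

text \<open>An operator is determined by its form. With \<open>T\<close> the adjoint of
  \<open>R\<close>, the form of \<open>T W(x) R\<close> is the form of \<open>W(x)\<close> pulled
  back by \<open>R\<close>, which by \<open>iso\<close> is the form of \<open>W'(x)\<close>.\<close>

lemma equivalent_weightsI:
  assumes V: "findim_space V" and V': "findim_space V'"
    and W: "\<And>x. x \<in> einterval a b \<Longrightarrow> clinear_on V V (W x)"
    and W': "\<And>x. x \<in> einterval a b \<Longrightarrow> clinear_on V' V' (W' x)"
    and R: "clinear_on V' V R" "bij_betw R V' V"
    and iso: "\<And>x u v. x \<in> einterval a b \<Longrightarrow> u \<in> V' \<Longrightarrow> v \<in> V' \<Longrightarrow>
      cinner (W' x u) v = cinner (W x (R u)) (R v)"
  shows "equivalent_weights a b V W V' W'"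
proof -
  obtain T where T: "clinear_on V V' T"
    and adj: "\<And>v w. v \<in> V \<Longrightarrow> w \<in> V' \<Longrightarrow> cinner (T v) w = cinner v (R w)"
    using adjoint_exists[OF V V' R(1)] by blast
  have "W' x w = T (W x (R w))" if x: "x \<in> einterval a b" and w: "w \<in> V'" for x w
  proof (rule cinner_eqI[OF V'])
    have WR: "W x (R w) \<in> V" using clinear_onD(1)[OF W[OF x]] clinear_onD(1)[OF R(1) w] by blast
    show "W' x w \<in> V'" by (rule clinear_onD(1)[OF W'[OF x] w])
    show "T (W x (R w)) \<in> V'" by (rule clinear_onD(1)[OF T WR])
    show "cinner (W' x w) v = cinner (T (W x (R w))) v" if v: "v \<in> V'" for v
      using iso[OF x w v] adj[OF WR v] by simp
  qed
  then show ?thesis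
    unfolding equivalent_weights_def adjoint_on_def
    using T R(1) adj adjoint_bij[OF V V' R T adj] by blast
qed

text \<open>The map is the adjoint of the given \<open>T\<close>. Equivalence only says that
  \<open>T\<close> is bijective; this passes to the adjoint by \<open>adjoint_bij\<close> with the
  two spaces exchanged.\<close>

lemma equivalent_weightsD:
  assumes V: "findim_space V" and V': "findim_space V'"
    and W: "\<And>x. x \<in> einterval a b \<Longrightarrow> clinear_on V V (W x)"
    and equiv: "equivalent_weights a b V W V' W'"
  shows "\<exists>R. clinear_on V' V R \<and> bij_betw R V' V \<and>
    (\<forall>x\<in>einterval a b. \<forall>u\<in>V'. \<forall>v\<in>V'. cinner (W' x u) v = cinner (W x (R u)) (R v))"
proof -
  obtain T R where T: "clinear_on V V' T" "bij_betw T V V'" and R: "clinear_on V' V R"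
    and adj: "\<And>v w. v \<in> V \<Longrightarrow> w \<in> V' \<Longrightarrow> cinner (T v) w = cinner v (R w)"
    and W': "\<And>x w. x \<in> einterval a b \<Longrightarrow> w \<in> V' \<Longrightarrow> W' x w = T (W x (R w))"
    using equiv unfolding equivalent_weights_def adjoint_on_def by blast
  have "cinner (R w) v = cinner w (T v)" if "v \<in> V" "w \<in> V'" for v w
    using adj[OF that] cinner_commute[of "R w" v] cinner_commute[of w "T v"] by simp
  then have "bij_betw R V' V" using adjoint_bij[OF V' V T R] by blast
  moreover have "cinner (W' x u) v = cinner (W x (R u)) (R v)"
    if "x \<in> einterval a b" "u \<in> V'" "v \<in> V'" for x u v
    using W'[OF that(1,2)] adj[of "W x (R u)" v] that(3)
      clinear_onD(1)[OF W[OF that(1)] clinear_onD(1)[OF R that(2)]] by simp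
  ultimately show ?thesis using R by blast
qed

lemma operator_weightD:
  assumes "operator_weight a b V W"
  shows "findim_space V" and "\<And>x. x \<in> einterval a b \<Longrightarrow> clinear_on V V (W x)"
    and "\<And>x u v. x \<in> einterval a b \<Longrightarrow> u \<in> V \<Longrightarrow> v \<in> V \<Longrightarrow> cinner (W x u) v = cnj (cinner (W x v) u)"
proof -
  show "findim_space V" "\<And>x. x \<in> einterval a b \<Longrightarrow> clinear_on V V (W x)"
    using assms by (auto simp: operator_weight_def)
  show "cinner (W x u) v = cnj (cinner (W x v) u)" if "x \<in> einterval a b" "u \<in> V" "v \<in> V" for x u v
  proof -
    have "cinner (W x u) v = cinner u (W x v)"
      using assms that by (auto simp: operator_weight_def possemidef_on_def adjoint_on_def)
    then show ?thesis using cinner_commute[of u "W x v"] by simp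
  qed
qed

text \<open>A nonempty open interval is not a null set, so definiteness almost everywhere provides
  at least one point \<open>x0\<close>. This is where \<open>a < b\<close> enters.\<close>

lemma operator_weight_form_space:
  assumes W: "operator_weight a b V W" and "a < b"
  shows "\<exists>x0. form_space V (einterval a b) (\<lambda>x u v. cinner (W x u) v) x0"
proof -
  have "\<exists>x\<in>einterval a b. posdef_on V (W x)"
  proof (rule ccontr)
    assume no: "\<not> (\<exists>x\<in>einterval a b. posdef_on V (W x))"
    have "AE x in lebesgue. x \<in> einterval a b \<longrightarrow> posdef_on V (W x)"
      using W by (simp add: operator_weight_def)
    then have "AE x in lebesgue. x \<notin> einterval a b"
      by (rule AE_mp) (use no in auto)
    then have "negligible (einterval a b)"
      by (subst (asm) AE_iff_null_sets[symmetric]) (auto simp: negligible_iff_null_sets)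
    moreover have "einterval a b \<noteq> {}" using einterval_nonempty[OF \<open>a < b\<close>] by blast
    ultimately show False using open_not_negligible open_einterval by blast
  qed
  then obtain x0 where x0: "x0 \<in> einterval a b" "posdef_on V (W x0)" by blast
  have "form_space V (einterval a b) (\<lambda>x u v. cinner (W x u) v) x0"
  proof
    show "findim_space V" by (rule operator_weightD[OF W])
    show "x0 \<in> einterval a b" by fact
    show "cinner (W x u) v = cnj (cinner (W x v) u)" if "x \<in> einterval a b" "u \<in> V" "v \<in> V" for x u v
      by (rule operator_weightD(3)[OF W that])
    show "0 < Re (cinner (W x0 v) v)" if "v \<in> V" "v \<noteq> 0" for v
      using x0(2) that by (simp add: posdef_on_def)
  qed (simp_all add: clinear_onD(2,3)[OF operator_weightD(2)[OF W]] cinner_add_left cinner_scaleC_left)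
  then show ?thesis by blast
qed

text \<open>Positivity and integrability are conditions on the values
  \<open>cinner (W x u) v\<close>, and those of \<open>W'\<close> are among those of
  \<open>W\<close>; injectivity of \<open>S\<close> preserves definiteness. It covers both a change
  of coordinates and the passage to an invariant subspace, where \<open>S\<close> is the
  inclusion.\<close>

lemma operator_weight_pullback:
  assumes W: "operator_weight a b V W" and U: "findim_space U"
    and S: "clinear_on U V S" "inj_on S U"
    and W': "\<And>x. x \<in> einterval a b \<Longrightarrow> clinear_on U U (W' x)"
    and iso: "\<And>x u v. x \<in> einterval a b \<Longrightarrow> u \<in> U \<Longrightarrow> v \<in> U \<Longrightarrow>
      cinner (W' x u) v = cinner (W x (S u)) (S v)"
  shows "operator_weight a b U W'"
proof -
  have SU: "S u \<in> V" if "u \<in> U" for u by (rule clinear_onD(1)[OF S(1) that])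
  have S0: "S u \<noteq> 0" if "u \<in> U" "u \<noteq> 0" for u
    using S(2) that clinear_on_zero[OF S(1)] findim_space_subspace[OF U]
    by (metis complex_vector.subspace_0 inj_on_def)
  have adj: "adjoint_on U U (W' x) (W' x)" if x: "x \<in> einterval a b" for x
  proof -
    have "cinner (W' x u) v = cinner u (W' x v)" if uv: "u \<in> U" "v \<in> U" for u v
      using operator_weightD(3)[OF W x SU[OF uv(1)] SU[OF uv(2)]] iso[OF x] uv
        cinner_commute[of u "W' x v"] by simp
    then show ?thesis using W'[OF x] by (simp add: adjoint_on_def)
  qed
  have pos: "possemidef_on U (W' x)" if x: "x \<in> einterval a b" for x
    using W x SU iso[OF x] adj[OF x] by (auto simp: operator_weight_def possemidef_on_def)
  have "posdef_on U (W' x)" if x: "x \<in> einterval a b" and p: "posdef_on V (W x)" for x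
    using p SU S0 iso[OF x] adj[OF x] by (auto simp: posdef_on_def)
  moreover have "AE x in lebesgue. x \<in> einterval a b \<longrightarrow> posdef_on V (W x)"
    using W by (simp add: operator_weight_def)
  ultimately have AE: "AE x in lebesgue. x \<in> einterval a b \<longrightarrow> posdef_on U (W' x)"
    by (auto elim!: eventually_mono)
  have int: "operator_integrable a b U (\<lambda>x v. complex_of_real (x ^ n) *\<^sub>C W' x v)" for n :: nat
    unfolding operator_integrable_def
  proof (intro ballI)
    fix u v assume uv: "u \<in> U" "v \<in> U"
    have "set_integrable lebesgue (einterval a b)
        (\<lambda>x. cinner (complex_of_real (x ^ n) *\<^sub>C W x (S u)) (S v))"
      using W SU uv by (auto simp: operator_weight_def operator_integrable_def)
    also have "?this \<longleftrightarrow> set_integrable lebesgue (einterval a b)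
        (\<lambda>x. cinner (complex_of_real (x ^ n) *\<^sub>C W' x u) v)"
      by (rule set_integrable_cong) (use iso uv in \<open>simp_all add: cinner_scaleC_left\<close>)
    finally show "set_integrable lebesgue (einterval a b)
        (\<lambda>x. cinner (complex_of_real (x ^ n) *\<^sub>C W' x u) v)" .
  qed
  moreover have "operator_integrable a b U W'"
    using int[of 0] by (simp add: complex_vector.scale_one)
  ultimately show ?thesis
    unfolding operator_weight_def using U W' pos AE by blast
qed

section \<open>Irreducible weights in terms of forms\<close>

lemma subspace_dim_less:
  assumes U: "findim_space U" and A: "complex_vector.subspace A" "A \<subseteq> U" "A \<noteq> U"
  shows "complex_vector.dim A < complex_vector.dim U"
proof -
  obtain B where B: "B \<subseteq> A" "complex_vector.independent B" "A \<subseteq> complex_vector.span B"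
      "card B = complex_vector.dim A"
    using complex_vector.basis_exists by blast
  obtain C where C: "C \<subseteq> U" "complex_vector.independent C" "U \<subseteq> complex_vector.span C"
      "card C = complex_vector.dim U"
    using complex_vector.basis_exists by blast
  obtain G where "finite G" "U = complex_vector.span G" using U by (auto simp: findim_space_def)
  then have "finite C" using complex_vector.independent_span_bound C(1,2) by blast
  obtain u where u: "u \<in> U" "u \<notin> A" using A by blast
  have "complex_vector.span B \<subseteq> A" using B(1) A(1) by (rule complex_vector.span_minimal)
  then have ind: "complex_vector.independent (insert u B)"
    using complex_vector.independent_insertI B(2) u(2) by blast
  have "insert u B \<subseteq> complex_vector.span C" using B(1) A(2) u(1) C(3) by blast
  then have "finite (insert u B) \<and> card (insert u B) \<le> card C"
    by (rule complex_vector.independent_span_bound[OF \<open>finite C\<close> ind])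
  moreover have "u \<notin> B" using u B(1) by blast
  ultimately show ?thesis using B(4) C(4) by auto
qed

text \<open>
  A form-orthogonal splitting \<open>U = A \<oplus> B\<close> need not be orthogonal for the inner product of \<open>U\<close>.
  If \<open>P\<close> and \<open>Q\<close> are the projections onto \<open>A\<close> that are orthogonal for the inner product and
  for the forms, respectively, then \<open>1 - Q + P\<close> is invertible with inverse \<open>1 - P + Q\<close>; it fixes
  \<open>A\<close> and carries its orthogonal complement to \<open>B\<close>.
\<close>

lemma irreducible_weight_form_irreducible:
  assumes irr: "irreducible_weight a b U W" and "a < b"
  shows "form_irreducible (einterval a b) (\<lambda>x u v. cinner (W x u) v) U"
  unfolding form_irreducible_def
proof (intro allI impI, elim conjE, rule ccontr)
  fix A B
  assume A: "complex_vector.subspace A" "A \<subseteq> U" and B: "complex_vector.subspace B" "B \<subseteq> U"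
    and split: "\<forall>u\<in>U. \<exists>p\<in>A. \<exists>q\<in>B. u = p + q"
    and orth: "\<forall>x\<in>einterval a b. \<forall>p\<in>A. \<forall>q\<in>B. cinner (W x p) q = 0"
    and nonzero: "\<not> (A = {0} \<or> B = {0})"
  have W: "operator_weight a b U W" using irr by (simp add: irreducible_weight_def)
  obtain x0 where "form_space U (einterval a b) (\<lambda>x u v. cinner (W x u) v) x0"
    using operator_weight_form_space[OF W \<open>a < b\<close>] by blast
  then interpret F: form_space U "einterval a b" "\<lambda>x u v. cinner (W x u) v" x0 .
  interpret C: form_space U UNIV "\<lambda>_::unit. cinner" "()" by (rule form_space_cinner[OF F.findim])
  have AU: "p \<in> U" if "p \<in> A" for p using A that by blast
  have BU: "q \<in> U" if "q \<in> B" for q using B that by blast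
  obtain P where P: "clinear_on U A P" "\<And>v w. v \<in> U \<Longrightarrow> w \<in> A \<Longrightarrow> cinner (P v) w = cinner v w"
    using C.projection_exists[OF A] by blast
  obtain Q where Q: "clinear_on U A Q"
    "\<And>v w. v \<in> U \<Longrightarrow> w \<in> A \<Longrightarrow> cinner (W x0 (Q v)) w = cinner (W x0 v) w"
    using F.projection_exists[OF A] by blast
  have PA: "P v \<in> A" "P v \<in> U" if "v \<in> U" for v using clinear_onD(1)[OF P(1) that] AU by auto
  have QA: "Q v \<in> A" "Q v \<in> U" if "v \<in> U" for v using clinear_onD(1)[OF Q(1) that] AU by auto
  have P_id: "P p = p" if "p \<in> A" for p
    using that PA P(2) AU by (intro C.h_eqI[OF A]) auto
  have Q_id: "Q p = p" if "p \<in> A" for p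
    using that QA Q(2) AU by (intro F.h_eqI[OF A]) auto
  have orth': "cinner (W x q) p = 0" if "x \<in> einterval a b" "p \<in> A" "q \<in> B" for x p q
    using F.h_commute[of x q p] orth that AU BU by simp
  \<comment> \<open>\<open>Q\<close> is defined through \<open>h x0\<close> alone, yet orthogonality
    of the splitting makes it the projection onto \<open>A\<close> along \<open>B\<close>.\<close>
  have Q_B: "Q q = 0" if "q \<in> B" for q
    using that QA(1) Q(2) orth' F.x0 BU AU F.h_zero_left[OF F.x0] complex_vector.subspace_0[OF A(1)]
    by (intro F.h_eqI[OF A]) auto
  define B' where "B' = {v \<in> U. P v = 0}"
  define S where "S v = v - Q v + P v" for v
  define G where "G v = v - P v + Q v" for v
  have SU: "S v \<in> U" if "v \<in> U" for v
    unfolding S_def using that PA(2) QA(2) by (intro F.V_closed)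
  have GU: "G v \<in> U" if "v \<in> U" for v
    unfolding G_def using that PA(2) QA(2) by (intro F.V_closed)
  note lin = clinear_onD(2)[OF P(1)] clinear_onD(2)[OF Q(1)]
    clinear_on_diff[OF P(1) F.subspace] clinear_on_diff[OF Q(1) F.subspace]
    clinear_onD(3)[OF P(1)] clinear_onD(3)[OF Q(1)]
  have S: "clinear_on U U S"
    unfolding clinear_on_def using SU
    by (auto simp: S_def lin complex_vector.scale_right_distrib complex_vector.scale_right_diff_distrib)
  \<comment> \<open>\<open>P\<close> and \<open>Q\<close> project onto the same \<open>A\<close>, so
    \<open>P Q = Q\<close> and \<open>Q P = P\<close>, and all mixed terms cancel.\<close>
  have "G (S v) = v" "S (G v) = v" if "v \<in> U" for v
    using that PA QA P_id Q_id by (simp_all add: S_def G_def lin F.V_closed)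
  then have S_bij: "bij_betw S U U"
    using SU GU by (intro bij_betw_byWitness[where f' = G]) auto
  have S_A: "S p = p" if "p \<in> A" for p using that P_id Q_id by (simp add: S_def)
  have S_B': "S v \<in> B" if "v \<in> B'" for v
  proof -
    have v: "v \<in> U" "P v = 0" using that by (auto simp: B'_def)
    obtain p q where pq: "p \<in> A" "q \<in> B" "v = p + q" using split v(1) by blast
    then have "Q v = p" using lin(2)[of p q] AU BU Q_id Q_B by simp
    then show ?thesis using v pq by (simp add: S_def)
  qed
  obtain T where T: "clinear_on U U T"
    and adj: "\<And>v w. v \<in> U \<Longrightarrow> w \<in> U \<Longrightarrow> cinner (T v) w = cinner v (S w)"
    using adjoint_exists[OF F.findim F.findim S] by blast
  \<comment> \<open>\<open>S\<^sup>* W S\<close> has the forms of \<open>W\<close> pulled back by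
    \<open>S\<close>, so the form splitting into \<open>A\<close> and \<open>B\<close> becomes one
    into \<open>A\<close> and \<open>B'\<close>, which is orthogonal for \<open>cinner\<close> as
    well.\<close>
  define W' where "W' x v = T (W x (S v))" for x v
  note Wlin = operator_weightD(2)[OF W]
  have W'lin: "clinear_on U U (W' x)" if "x \<in> einterval a b" for x
    unfolding W'_def by (rule clinear_on_compose[OF clinear_on_compose[OF S Wlin[OF that]] T])
  have iso: "cinner (W' x u) v = cinner (W x (S u)) (S v)"
    if "x \<in> einterval a b" "u \<in> U" "v \<in> U" for x u v
    unfolding W'_def using that adj clinear_onD(1)[OF Wlin[OF that(1)]] SU by blast
  have W': "operator_weight a b U W'"
    by (rule operator_weight_pullback[OF W F.findim S _ W'lin iso]) (use S_bij in \<open>simp add: bij_betw_def\<close>)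
  have W'U: "W' x u \<in> U" if "x \<in> einterval a b" "u \<in> U" for x u
    by (rule clinear_onD(1)[OF W'lin[OF that(1)] that(2)])
  have B'_sub: "complex_vector.subspace B'"
    unfolding B'_def using F.V_closed clinear_on_zero[OF P(1) F.subspace]
    by (auto intro!: complex_vector.subspaceI simp: lin)
  have B'U: "B' \<subseteq> U" by (auto simp: B'_def)
  have rest: "u - P u \<in> B'" if "u \<in> U" for u
    using that PA P_id by (simp add: B'_def lin F.V_closed)
  have orth_B': "cinner p q = 0" "cinner q p = 0" if "p \<in> A" "q \<in> B'" for p q
  proof -
    have "q \<in> U" "P q = 0" using that by (auto simp: B'_def)
    then show "cinner q p = 0" using P(2)[of q p] that C.h_zero_left[of "()" p] AU by simp
    then show "cinner p q = 0" using cinner_commute[of p q] by simp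
  qed
  have W'A: "W' x p \<in> A" if x: "x \<in> einterval a b" and p: "p \<in> A" for x p
  proof -
    let ?z = "W' x p"
    have z: "?z \<in> U" using W'U x p AU by blast
    have "cinner ?z q = 0" if "q \<in> B'" for q
      using iso[OF x AU[OF p], of q] S_A[OF p] S_B'[OF that] orth x p that B'U by auto
    \<comment> \<open>\<open>?z\<close> is orthogonal to \<open>B'\<close>, which contains
      \<open>?z - P ?z\<close>; that vector is also orthogonal to \<open>P ?z\<close> in
      \<open>A\<close>, hence to itself.\<close>
    then have "cinner (?z - P ?z) (?z - P ?z) = 0"
      using rest[OF z] orth_B'(1)[OF PA(1)[OF z] rest[OF z]] C.h_diff_left[of "()"] z PA(2)[OF z]
      by (simp add: F.V_closed)
    then have "?z = P ?z" by (simp add: cinner_eq_zero_iff)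
    then show ?thesis using PA(1)[OF z] by simp
  qed
  have W'B': "W' x q \<in> B'" if x: "x \<in> einterval a b" and q: "q \<in> B'" for x q
  proof -
    let ?z = "W' x q"
    have qU: "q \<in> U" using q B'U by blast
    have z: "?z \<in> U" using W'U x qU by blast
    have "cinner ?z p = 0" if "p \<in> A" for p
      using iso[OF x qU AU[OF that]] S_A[OF that] S_B'[OF q] orth'[OF x that] by simp
    then have "cinner (P ?z) (P ?z) = 0" using P(2)[OF z] PA(1)[OF z] by simp
    then show ?thesis using z by (simp add: B'_def cinner_eq_zero_iff)
  qed
  have weight_sub: "operator_weight a b D W'"
    if D: "complex_vector.subspace D" "D \<subseteq> U" "\<And>x v. x \<in> einterval a b \<Longrightarrow> v \<in> D \<Longrightarrow> W' x v \<in> D" for D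
  proof (rule operator_weight_pullback[OF W', where S = "\<lambda>v. v"])
    show "findim_space D" by (rule findim_space_subset[OF F.findim D(1,2)])
    show "clinear_on D U (\<lambda>v. v)" using D(2) by (auto simp: clinear_on_def)
    show "clinear_on D D (W' x)" if "x \<in> einterval a b" for x
      using D(2,3) W'lin that unfolding clinear_on_def by blast
  qed auto
  obtain p0 where p0: "p0 \<in> A" "p0 \<noteq> 0" using nonzero complex_vector.subspace_0[OF A(1)] by blast
  obtain q0 where q0: "q0 \<in> B" "q0 \<noteq> 0" using nonzero complex_vector.subspace_0[OF B(1)] by blast
  \<comment> \<open>\<open>Q\<close> fixes \<open>A\<close> and kills \<open>B\<close>, so a nonzero
    vector of \<open>B\<close> cannot lie in \<open>A\<close>.\<close>
  have "q0 \<notin> A" using Q_id[of q0] Q_B[of q0] q0 by auto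
  then have "A \<noteq> U" using q0 BU by blast
  have "q0 - P q0 \<noteq> 0" using \<open>q0 \<notin> A\<close> PA(1)[OF BU[OF q0(1)]] by auto
  then have "B' \<noteq> {0}" using rest[OF BU[OF q0(1)]] by blast
  have "p0 \<notin> B'" using P_id p0 by (simp add: B'_def)
  then have "B' \<noteq> U" using p0 AU by blast
  define Vs where "Vs i = (if i = (1::nat) then A else B')" for i
  have two: "{1..2} = {1::nat, 2}" by auto
  have Vs: "complex_vector.subspace (Vs i)" "Vs i \<subseteq> U" "Vs i \<noteq> {0}" "Vs i \<noteq> U"
      "\<And>x v. x \<in> einterval a b \<Longrightarrow> v \<in> Vs i \<Longrightarrow> W' x v \<in> Vs i" for i
    using A B'_sub B'U nonzero \<open>A \<noteq> U\<close> \<open>B' \<noteq> {0}\<close> \<open>B' \<noteq> U\<close> W'A W'B' by (auto simp: Vs_def)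
  have "orthogonal_direct_sum a b U W' 2 Vs (\<lambda>_. W')"
    unfolding orthogonal_direct_sum_def
  proof (intro conjI ballI impI)
    fix i k :: nat and u v
    assume "i \<in> {1..2}" "k \<in> {1..2}" "i \<noteq> k" "u \<in> Vs i" "v \<in> Vs k"
    then show "cinner u v = 0" using orth_B' by (auto simp: two Vs_def split: if_splits)
  next
    show "U = {\<Sum>i = 1..2. v i |v. \<forall>i\<in>{1..2}. v i \<in> Vs i}"
    proof (intro equalityI subsetI)
      fix u assume u: "u \<in> U"
      show "u \<in> {\<Sum>i = 1..2. v i |v. \<forall>i\<in>{1..2}. v i \<in> Vs i}"
        using PA(1)[OF u] rest[OF u]
        by (intro CollectI exI[of _ "\<lambda>i. if i = 1 then P u else u - P u"]) (simp add: two Vs_def del: One_nat_def)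
    next
      fix u assume "u \<in> {\<Sum>i = 1..2. v i |v. \<forall>i\<in>{1..2}. v i \<in> Vs i}"
      then obtain v where "u = (\<Sum>i = 1..2. v i)" "\<forall>i\<in>{1..2}. v i \<in> Vs i" by blast
      then show "u \<in> U" using Vs(2) by (metis (no_types, lifting) F.V_closed(4) subsetD)
    qed
  qed (use Vs in auto)
  moreover have "operator_weight a b (Vs i) W'" "complex_vector.dim (Vs i) < complex_vector.dim U" for i
    using weight_sub[OF Vs(1,2,5)] subspace_dim_less[OF F.findim Vs(1,2,4)] by auto
  moreover have "equivalent_weights a b U W U W'"
    by (rule equivalent_weightsI[OF F.findim F.findim Wlin W'lin S S_bij iso])
  ultimately show False using irr W' unfolding irreducible_weight_def by blast
qed

section \<open>Direct sums of weights and uniqueness of the summands\<close>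

lemma orthogonal_direct_sumD:
  assumes "orthogonal_direct_sum a b V W d Vs Ws"
  shows "\<And>i. i \<in> {1..d} \<Longrightarrow> complex_vector.subspace (Vs i)" "\<And>i. i \<in> {1..d} \<Longrightarrow> Vs i \<noteq> {0}"
    and "\<And>i. i \<in> {1..d} \<Longrightarrow> Vs i \<subseteq> V"
    and "\<And>i x v. i \<in> {1..d} \<Longrightarrow> x \<in> einterval a b \<Longrightarrow> v \<in> Vs i \<Longrightarrow> W x v \<in> Vs i"
    and "\<And>i x v. i \<in> {1..d} \<Longrightarrow> x \<in> einterval a b \<Longrightarrow> v \<in> Vs i \<Longrightarrow> Ws i x v = W x v"
proof -
  show *: "\<And>i. i \<in> {1..d} \<Longrightarrow> complex_vector.subspace (Vs i)" "\<And>i. i \<in> {1..d} \<Longrightarrow> Vs i \<noteq> {0}"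
    "\<And>i x v. i \<in> {1..d} \<Longrightarrow> x \<in> einterval a b \<Longrightarrow> v \<in> Vs i \<Longrightarrow> W x v \<in> Vs i"
    "\<And>i x v. i \<in> {1..d} \<Longrightarrow> x \<in> einterval a b \<Longrightarrow> v \<in> Vs i \<Longrightarrow> Ws i x v = W x v"
    using assms unfolding orthogonal_direct_sum_def by blast+
  show "Vs i \<subseteq> V" if i: "i \<in> {1..d}" for i
  proof
    fix v assume v: "v \<in> Vs i"
    have V: "V = {\<Sum>i=1..d. v i | v. \<forall>i\<in>{1..d}. v i \<in> Vs i}"
      using assms unfolding orthogonal_direct_sum_def by blast
    let ?c = "\<lambda>k. if k = i then v else 0"
    have "(\<Sum>k=1..d. ?c k) = v" using i by simp
    moreover have "\<forall>k\<in>{1..d}. ?c k \<in> Vs k" using v complex_vector.subspace_0[OF *(1)] by simp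
    ultimately show "v \<in> V" unfolding V by (intro CollectI exI[of _ ?c]) simp
  qed
qed

text \<open>Since \<open>W x\<close> maps \<open>Vs i\<close> into itself, \<open>W x u\<close>
  stays orthogonal to the other summands for \<open>cinner\<close>, which is orthogonality for every
  form.\<close>

lemma orthogonal_direct_sum_form_decomposition:
  assumes D: "orthogonal_direct_sum a b V W d Vs Ws"
    and F: "form_space V (einterval a b) (\<lambda>x u v. cinner (W x u) v) x0"
  shows "form_space.form_decomposition V (einterval a b) (\<lambda>x u v. cinner (W x u) v) {1..d} Vs"
proof -
  interpret form_space V "einterval a b" "\<lambda>x u v. cinner (W x u) v" x0 by fact
  note DD = orthogonal_direct_sumD[OF D]
  have orth: "cinner u v = 0" if "i \<in> {1..d}" "k \<in> {1..d}" "i \<noteq> k" "u \<in> Vs i" "v \<in> Vs k" for i k u v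
    using D that unfolding orthogonal_direct_sum_def by blast
  show ?thesis
    unfolding form_decomposition_def
  proof (intro conjI ballI impI)
    fix i k x u v
    assume "i \<in> {1..d}" "k \<in> {1..d}" "i \<noteq> k" "x \<in> einterval a b" "u \<in> Vs i" "v \<in> Vs k"
    then show "cinner (W x u) v = 0" using orth[of i k "W x u" v] DD(4) by blast
  next
    fix v assume "v \<in> V"
    moreover have "V = {\<Sum>i=1..d. v i | v. \<forall>i\<in>{1..d}. v i \<in> Vs i}"
      using D unfolding orthogonal_direct_sum_def by blast
    ultimately show "\<exists>c. (\<forall>i\<in>{1..d}. c i \<in> Vs i) \<and> v = (\<Sum>i\<in>{1..d}. c i)" by blast
  qed (use DD in auto)
qed

theorem theorem2p16:
  fixes a b :: ereal
    and V :: "'a::complex_inner set" and V' :: "'b::complex_inner set"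
    and W :: "real \<Rightarrow> 'a \<Rightarrow> 'a" and W' :: "real \<Rightarrow> 'b \<Rightarrow> 'b"
    and j j' :: nat
    and Vs :: "nat \<Rightarrow> 'a set" and Vs' :: "nat \<Rightarrow> 'b set"
    and Ws :: "nat \<Rightarrow> real \<Rightarrow> 'a \<Rightarrow> 'a" and Ws' :: "nat \<Rightarrow> real \<Rightarrow> 'b \<Rightarrow> 'b"
  assumes "a < b"
    and "operator_weight a b V W"
    and "operator_weight a b V' W'"
    and "orthogonal_direct_sum a b V W j Vs Ws"
    and "orthogonal_direct_sum a b V' W' j' Vs' Ws'"
    and "\<And>i. i \<in> {1..j} \<Longrightarrow> irreducible_weight a b (Vs i) (Ws i)"
    and "\<And>i. i \<in> {1..j'} \<Longrightarrow> irreducible_weight a b (Vs' i) (Ws' i)"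
    and "equivalent_weights a b V W V' W'"
  shows "j = j' \<and>
    (\<exists>\<sigma>. \<sigma> permutes {1..j} \<and>
      (\<forall>i\<in>{1..j}. equivalent_weights a b (Vs i) (Ws i) (Vs' (\<sigma> i)) (Ws' (\<sigma> i))))"
proof -
  let ?X = "einterval a b"
  let ?h = "\<lambda>x u v. cinner (W x u) v" and ?h' = "\<lambda>x u v. cinner (W' x u) v"
  obtain x0 where F: "form_space V ?X ?h x0"
    using operator_weight_form_space[OF assms(2,1)] by blast
  obtain x0' where F': "form_space V' ?X ?h' x0'"
    using operator_weight_form_space[OF assms(3,1)] by blast
  interpret F: form_space V ?X ?h x0 by (rule F)
  note DD = orthogonal_direct_sumD[OF assms(4)] and DD' = orthogonal_direct_sumD[OF assms(5)]
  note ow = operator_weightD[OF assms(2)] and ow' = operator_weightD[OF assms(3)]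
  \<comment> \<open>\<open>R\<close> is the adjoint of the equivalence and hence runs from
    \<open>V'\<close> to \<open>V\<close>, so both decompositions are compared inside
    \<open>V\<close>.\<close>
  obtain R where R: "clinear_on V' V R" "bij_betw R V' V"
    and iso: "\<And>x u v. x \<in> ?X \<Longrightarrow> u \<in> V' \<Longrightarrow> v \<in> V' \<Longrightarrow> ?h' x u v = ?h x (R u) (R v)"
    using equivalent_weightsD[OF ow(1) ow'(1) ow(2) assms(8)] by blast
  have Rk: "clinear_on (Vs' k) (R ` Vs' k) R" "bij_betw R (Vs' k) (R ` Vs' k)" if "k \<in> {1..j'}" for k
  proof -
    show "clinear_on (Vs' k) (R ` Vs' k) R"
      using R(1) DD'(3)[OF that] unfolding clinear_on_def by blast
    show "bij_betw R (Vs' k) (R ` Vs' k)"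
      using R(2) DD'(3)[OF that] unfolding bij_betw_def by (blast intro: inj_on_subset)
  qed
  have D: "F.form_decomposition {1..j} Vs"
    by (rule orthogonal_direct_sum_form_decomposition[OF assms(4) F])
  have D': "F.form_decomposition {1..j'} (\<lambda>k. R ` Vs' k)"
    by (rule form_decomposition_image[OF F F' R iso
          orthogonal_direct_sum_form_decomposition[OF assms(5) F']])
  have irr: "form_irreducible ?X ?h (Vs i)" if i: "i \<in> {1..j}" for i
    by (rule form_irreducible_cong[OF irreducible_weight_form_irreducible[OF assms(6)[OF i] assms(1)]])
      (simp add: DD(5)[OF i])
  have irr': "form_irreducible ?X ?h (R ` Vs' k)" if k: "k \<in> {1..j'}" for k
  proof (rule form_irreducible_image[OF Rk[OF k] DD'(1)[OF k]
        irreducible_weight_form_irreducible[OF assms(7)[OF k] assms(1)]])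
    show "cinner (Ws' k x u) v = ?h x (R u) (R v)" if "x \<in> ?X" "u \<in> Vs' k" "v \<in> Vs' k" for x u v
      using iso[of x u v] that DD'(3)[OF k] DD'(5)[OF k] by auto
  qed
  have nz': "R ` Vs' k \<noteq> {0}" if k: "k \<in> {1..j'}" for k
  proof
    assume z: "R ` Vs' k = {0}"
    have "R 0 = 0" by (rule clinear_on_zero[OF Rk(1)[OF k] DD'(1)[OF k]])
    then have "Vs' k \<subseteq> {0}"
      using z inj_onD[OF bij_betw_imp_inj_on[OF Rk(2)[OF k]]] complex_vector.subspace_0[OF DD'(1)[OF k]]
      by (metis imageI singletonD singletonI subsetI)
    then show False using DD'(2)[OF k] complex_vector.subspace_0[OF DD'(1)[OF k]] by blast
  qed
  obtain \<sigma> where jj: "j = j'" and \<sigma>: "\<sigma> permutes {1..j}"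
    and matched: "\<And>i. i \<in> {1..j} \<Longrightarrow> F.isometric (Vs i) (R ` Vs' (\<sigma> i))"
    using F.krull_schmidt[OF D D' irr DD(2) irr' nz'] by blast
  have "equivalent_weights a b (Vs i) (Ws i) (Vs' (\<sigma> i)) (Ws' (\<sigma> i))" if i: "i \<in> {1..j}" for i
  proof -
    define k where "k = \<sigma> i"
    have k: "k \<in> {1..j'}" using i unfolding k_def jj[symmetric] permutes_in_image[OF \<sigma>] .
    \<comment> \<open>The direction is reversed because an equivalence from \<open>Vs i\<close> to
      \<open>Vs' k\<close> is obtained from a form-preserving map from \<open>Vs' k\<close> to
      \<open>Vs i\<close>.\<close>
    have "F.isometric (R ` Vs' k) (Vs i)"
      by (rule F.isometric_sym[OF DD(1)[OF i] matched[OF i, folded k_def]])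
    then obtain g where g: "clinear_on (R ` Vs' k) (Vs i) g" "bij_betw g (R ` Vs' k) (Vs i)"
      and g_iso: "\<And>x u v. x \<in> ?X \<Longrightarrow> u \<in> R ` Vs' k \<Longrightarrow> v \<in> R ` Vs' k \<Longrightarrow> ?h x (g u) (g v) = ?h x u v"
      unfolding F.isometric_def by blast
    have owi: "operator_weight a b (Vs i) (Ws i)" and owk: "operator_weight a b (Vs' k) (Ws' k)"
      using assms(6)[OF i] assms(7)[OF k] by (simp_all add: irreducible_weight_def)
    have gR: "clinear_on (Vs' k) (Vs i) (\<lambda>v. g (R v))"
      by (rule clinear_on_compose[OF Rk(1)[OF k] g(1)])
    show ?thesis
      unfolding k_def[symmetric]
    proof (rule equivalent_weightsI[OF operator_weightD(1)[OF owi] operator_weightD(1)[OF owk]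
          operator_weightD(2)[OF owi] operator_weightD(2)[OF owk] gR])
      show "bij_betw (\<lambda>v. g (R v)) (Vs' k) (Vs i)"
        using bij_betw_trans[OF Rk(2)[OF k] g(2)] by (simp add: comp_def)
      show "cinner (Ws' k x u) v = cinner (Ws i x (g (R u))) (g (R v))"
        if x: "x \<in> ?X" and uv: "u \<in> Vs' k" "v \<in> Vs' k" for x u v
      proof -
        have "cinner (Ws' k x u) v = ?h' x u v" using DD'(5)[OF k x uv(1)] by simp
        also have "\<dots> = ?h x (R u) (R v)" using iso[OF x] uv DD'(3)[OF k] by blast
        also have "\<dots> = ?h x (g (R u)) (g (R v))" using g_iso[OF x] uv by simp
        also have "\<dots> = cinner (Ws i x (g (R u))) (g (R v))"
          using DD(5)[OF i x clinear_onD(1)[OF gR uv(1)]] by simp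
        finally show ?thesis .
      qed
    qed
  qed
  then show ?thesis using jj \<sigma> by blast
qed

end
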